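(* The nested deduction Frege system $nd\mathscr{F}$ and the nested disjunction Frege system $no\mathscr{F}$ (both built over the same classical Frege system $\mathscr{F}$) linearly simulate one another: there is an algorithm transforming any $nd\mathscr{F}$ proof of a formula $A$ with $n$ steps into an $no\mathscr{F}$ proof of $A$ with $O(n)$ steps, and an algorithm transforming any $no\mathscr{F}$ proof of $A$ with $n$ steps into an $nd\mathscr{F}$ proof of $A$ with $O(n)$ steps.
   Context: Formulas of classical propositional logic are built from variables with $\wedge,\vee,\supset,\neg$. $\mathscr{F}$ is a fixed Frege system for classical propositional logic (finitely many axiom schemas, sole rule modus ponens; e.g. Kleene's system), containing the schema $(A\supset C)\supset((B\supset C)\supset((A\vee B)\supset C))$. Nested systems: a proof is a sequence of lines, each line being a formula together with its context, a finite sequence $\Gamma$ of currently open assumptions (initially empty). A line is available to a later line if its context is an initial subsequence of the later line's context and it lies in no assumption block that has already been closed. Allowed lines: (i) an instance of an axiom schema of $\mathscr{F}$ (context unchanged); (ii) opening an assumption $A$: the line $A$ with context $\Gamma*\langle A\rangle$, where $\Gamma$ is the context of the last available line; (iii) modus ponens from available lines $A$ and $A\supset B$, giving $B$ in the current context. In $nd\mathscr{F}$ one additionally has the nested deduction rule: if a block opened by assumption $A$ in context $\Gamma*\langle A\rangle$ ends with $B$, then one may close the block and write $A\supset B$ in context $\Gamma$; the lines of the closed block become unavailable. In $no\mathscr{F}$ one instead has the nested disjunction elimination rule $\vee_{ne}$: if $A\vee B$ is available in context $\Gamma$, a block opened by assumption $A$ (context $\Gamma*\langle A\rangle$) ends with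 $C$, and a subsequent block opened by assumption $B$ (context $\Gamma*\langle B\rangle$) ends with $C$, one may close both blocks and write $C$ in context $\Gamma$; lines of the closed blocks become unavailable. A proof of $A$ is such a sequence whose last line is $A$ with empty context; the number of steps is the number of lines. *)

theory Defs
  imports Main "HOL-Library.Sublist" "HOL-Library.Nat_Bijection"
begin

section \<open>Classical propositional formulas\<close>

datatype form =
    Var nat
  | And form form
  | Or form form
  | Imp form form
  | Neg form

primrec holds :: "(nat \<Rightarrow> bool) \<Rightarrow> form \<Rightarrow> bool" where
  "holds v (Var n) \<longleftrightarrow> v n"
| "holds v (And A B) \<longleftrightarrow> holds v A \<and> holds v B"
| "holds v (Or A B) \<longleftrightarrow> holds v A \<or> holds v B"
| "holds v (Imp A B) \<longleftrightarrow> (holds v A \<longrightarrow> holds v B)"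
| "holds v (Neg A) \<longleftrightarrow> \<not> holds v A"

definition tautology :: "form \<Rightarrow> bool" where
  "tautology A \<longleftrightarrow> (\<forall>v. holds v A)"

primrec subst :: "(nat \<Rightarrow> form) \<Rightarrow> form \<Rightarrow> form" where
  "subst \<sigma> (Var n) = \<sigma> n"
| "subst \<sigma> (And A B) = And (subst \<sigma> A) (subst \<sigma> B)"
| "subst \<sigma> (Or A B) = Or (subst \<sigma> A) (subst \<sigma> B)"
| "subst \<sigma> (Imp A B) = Imp (subst \<sigma> A) (subst \<sigma> B)"
| "subst \<sigma> (Neg A) = Neg (subst \<sigma> A)"

section \<open>Frege systems\<close>

text \<open>
  An axiom schema is a formula whose variables play the role of metavariables; its instances are
  its substitution instances. Modus ponens being the only rule, a Frege system is given by its
  set of axiom schemas.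
\<close>

definition axiom_instance :: "form set \<Rightarrow> form \<Rightarrow> bool" where
  "axiom_instance F A \<longleftrightarrow> (\<exists>S \<in> F. \<exists>\<sigma>. A = subst \<sigma> S)"

inductive frege_provable :: "form set \<Rightarrow> form \<Rightarrow> bool" for F where
  ax: "axiom_instance F A \<Longrightarrow> frege_provable F A"
| mp: "frege_provable F A \<Longrightarrow> frege_provable F (Imp A B) \<Longrightarrow> frege_provable F B"

definition or_elim_schema :: "form \<Rightarrow> form \<Rightarrow> form \<Rightarrow> form" where
  "or_elim_schema A B C = Imp (Imp A C) (Imp (Imp B C) (Imp (Or A B) C))"

text \<open>The last conjunct is membership of the schema up to the choice of its metavariables.\<close>

definition classical_frege_system :: "form set \<Rightarrow> bool" where
  "classical_frege_system F \<longleftrightarrow>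
     finite F \<and>
     (\<forall>A. frege_provable F A \<longleftrightarrow> tautology A) \<and>
     (\<exists>a b c. distinct [a, b, c] \<and> or_elim_schema (Var a) (Var b) (Var c) \<in> F)"

section \<open>Nested systems\<close>

type_synonym ctx = "form list"
type_synonym line = "ctx \<times> form"

definition current_ctx :: "line list \<Rightarrow> ctx" where
  "current_ctx P = (if P = [] then [] else fst (last P))"

text \<open>\<open>U\<close> is the set of positions of the lines that lie in a closed assumption block.\<close>

definition available :: "line list \<Rightarrow> nat set \<Rightarrow> ctx \<Rightarrow> form \<Rightarrow> bool" where
  "available P U \<Gamma> A \<longleftrightarrow>
     (\<exists>i < length P. i \<notin> U \<and> prefix (fst (P ! i)) \<Gamma> \<and> snd (P ! i) = A)"

text \<open>
  \<open>nd_lines F P S U\<close>: the lines \<open>P\<close> have been written correctly; \<open>S\<close> lists the positions at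
  which the currently open blocks start (innermost first), and \<open>U\<close> is as above.
\<close>

inductive nd_lines :: "form set \<Rightarrow> line list \<Rightarrow> nat list \<Rightarrow> nat set \<Rightarrow> bool" for F where
  nd_empty: "nd_lines F [] [] {}"
| nd_axiom: "\<lbrakk>nd_lines F P S U; axiom_instance F A\<rbrakk>
    \<Longrightarrow> nd_lines F (P @ [(current_ctx P, A)]) S U"
| nd_assume: "nd_lines F P S U
    \<Longrightarrow> nd_lines F (P @ [(current_ctx P @ [A], A)]) (length P # S) U"
| nd_mp: "\<lbrakk>nd_lines F P S U;
      available P U (current_ctx P) A; available P U (current_ctx P) (Imp A B)\<rbrakk>
    \<Longrightarrow> nd_lines F (P @ [(current_ctx P, B)]) S U"
| nd_deduction: "\<lbrakk>nd_lines F P (i # S) U;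
      P ! i = (\<Gamma> @ [A], A); last P = (\<Gamma> @ [A], B)\<rbrakk>
    \<Longrightarrow> nd_lines F (P @ [(\<Gamma>, Imp A B)]) S (U \<union> {i..<length P})"

definition nd_proof :: "form set \<Rightarrow> line list \<Rightarrow> form \<Rightarrow> bool" where
  "nd_proof F P A \<longleftrightarrow> (\<exists>S U. nd_lines F P S U) \<and> P \<noteq> [] \<and> last P = ([], A)"

text \<open>
  In the nested disjunction system a block is either the first block of a pair, starting at
  position \<open>i\<close> (\<open>First i\<close>), or the second one, starting at position \<open>k\<close>, the first one having
  occupied positions \<open>i, \<dots>, k - 1\<close> (\<open>Second i k\<close>). As the context of the second block
  is \<open>\<Gamma> * \<langle>B\<rangle>\<close> and not \<open>\<Gamma> * \<langle>A\<rangle> * \<langle>B\<rangle>\<close>, the first block is left, and its lines become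
  unavailable, when the second one is opened. This is recorded explicitly because it cannot be
  read off the contexts if \<open>A = B\<close>.
\<close>

datatype block = First nat | Second nat nat

inductive no_lines :: "form set \<Rightarrow> line list \<Rightarrow> block list \<Rightarrow> nat set \<Rightarrow> bool" for F where
  no_empty: "no_lines F [] [] {}"
| no_axiom: "\<lbrakk>no_lines F P S U; axiom_instance F A\<rbrakk>
    \<Longrightarrow> no_lines F (P @ [(current_ctx P, A)]) S U"
| no_assume: "no_lines F P S U
    \<Longrightarrow> no_lines F (P @ [(current_ctx P @ [A], A)]) (First (length P) # S) U"
| no_assume_second: "\<lbrakk>no_lines F P (First i # S) U; current_ctx P = \<Gamma> @ [A]\<rbrakk>
    \<Longrightarrow> no_lines F (P @ [(\<Gamma> @ [B], B)]) (Second i (length P) # S) (U \<union> {i..<length P})"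
| no_mp: "\<lbrakk>no_lines F P S U;
      available P U (current_ctx P) A; available P U (current_ctx P) (Imp A B)\<rbrakk>
    \<Longrightarrow> no_lines F (P @ [(current_ctx P, B)]) S U"
| no_or_elim: "\<lbrakk>no_lines F P (Second i k # S) U; available P U \<Gamma> (Or A B);
      P ! i = (\<Gamma> @ [A], A); P ! (k - 1) = (\<Gamma> @ [A], C);
      P ! k = (\<Gamma> @ [B], B); last P = (\<Gamma> @ [B], C)\<rbrakk>
    \<Longrightarrow> no_lines F (P @ [(\<Gamma>, C)]) S (U \<union> {k..<length P})"

definition no_proof :: "form set \<Rightarrow> line list \<Rightarrow> form \<Rightarrow> bool" where
  "no_proof F P A \<longleftrightarrow> (\<exists>S U. no_lines F P S U) \<and> P \<noteq> [] \<and> last P = ([], A)"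

section \<open>Algorithms\<close>

text \<open>
  Partial recursive functions on the natural numbers, in unary form: several arguments are
  passed through the pairing function \<open>prod_encode\<close>.
\<close>

inductive partial_recursive :: "(nat \<Rightarrow> nat option) \<Rightarrow> bool" where
  pr_zero: "partial_recursive (\<lambda>n. Some 0)"
| pr_suc: "partial_recursive (\<lambda>n. Some (Suc n))"
| pr_fst: "partial_recursive (\<lambda>n. Some (fst (prod_decode n)))"
| pr_snd: "partial_recursive (\<lambda>n. Some (snd (prod_decode n)))"
| pr_pair: "\<lbrakk>partial_recursive f; partial_recursive g\<rbrakk>
    \<Longrightarrow> partial_recursive
          (\<lambda>n. Option.bind (f n) (\<lambda>x. Option.bind (g n) (\<lambda>y. Some (prod_encode (x, y)))))"
| pr_comp: "\<lbrakk>partial_recursive f; partial_recursive g\<rbrakk>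
    \<Longrightarrow> partial_recursive (\<lambda>n. Option.bind (g n) f)"
| pr_rec: "\<lbrakk>partial_recursive f; partial_recursive g\<rbrakk>
    \<Longrightarrow> partial_recursive
          (\<lambda>n. rec_nat (f (fst (prod_decode n)))
                 (\<lambda>k r. Option.bind r
                    (\<lambda>y. g (prod_encode (fst (prod_decode n), prod_encode (k, y)))))
                 (snd (prod_decode n)))"
| pr_mu: "partial_recursive f
    \<Longrightarrow> partial_recursive
          (\<lambda>n. if \<exists>m. f (prod_encode (n, m)) = Some 0 \<and>
                      (\<forall>k<m. f (prod_encode (n, k)) \<noteq> None)
               then Some (LEAST m. f (prod_encode (n, m)) = Some 0)
               else None)"

primrec form_encode :: "form \<Rightarrow> nat" where
  "form_encode (Var n) = prod_encode (0, n)"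
| "form_encode (And A B) = prod_encode (1, prod_encode (form_encode A, form_encode B))"
| "form_encode (Or A B) = prod_encode (2, prod_encode (form_encode A, form_encode B))"
| "form_encode (Imp A B) = prod_encode (3, prod_encode (form_encode A, form_encode B))"
| "form_encode (Neg A) = prod_encode (4, form_encode A)"

definition line_encode :: "line \<Rightarrow> nat" where
  "line_encode l = prod_encode (list_encode (map form_encode (fst l)), form_encode (snd l))"

definition proof_encode :: "line list \<Rightarrow> nat" where
  "proof_encode P = list_encode (map line_encode P)"

text \<open>
  \<open>linearly_simulates Q_proof P_proof\<close>: some algorithm turns each proof in the second system
  into a proof in the first system of the same formula, with linear growth of the number of steps.
\<close>

definition linearly_simulates ::
  "(line list \<Rightarrow> form \<Rightarrow> bool) \<Rightarrow> (line list \<Rightarrow> form \<Rightarrow> bool) \<Rightarrow> bool" where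
  "linearly_simulates Q_proof P_proof \<longleftrightarrow>
     (\<exists>f c. partial_recursive f \<and>
        (\<forall>P A. P_proof P A \<longrightarrow>
           (\<exists>Q. f (proof_encode P) = Some (proof_encode Q) \<and>
                Q_proof Q A \<and> length Q \<le> c * length P)))"

end

theory Submission imports Defs begin

text \<open>
  In one direction, a block deriving \<open>B\<close> from \<open>A\<close> is replaced by an elimination of the
  disjunction \<open>A \<or> \<not> A\<close>, proved just before the block, with conclusion \<open>A \<supset> B\<close> in both cases.
  In the other, the two blocks of a disjunction elimination are closed by the deduction rule,
  giving \<open>A \<supset> C\<close> and \<open>B \<supset> C\<close>, from which \<open>C\<close> follows by the disjunction schema. All the
  auxiliary derivations are instances of fixed ones, so each line costs boundedly many lines.
  The rule that produced a line can be read off its context and that of the previous line, except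
  for axioms and modus ponens, which are copied, and for a second assumption equal to the first.
  Hence both translations are computed by a single pass over the proof.
\<close>

section \<open>Computable functions on encoded data\<close>

definition total_recursive :: "(nat \<Rightarrow> nat) \<Rightarrow> bool" where
  "total_recursive f \<longleftrightarrow> partial_recursive (\<lambda>n. Some (f n))"

lemma total_recursive_zero: "total_recursive (\<lambda>n. 0)"
  unfolding total_recursive_def by (rule pr_zero)

lemma total_recursive_Suc: "total_recursive Suc"
  unfolding total_recursive_def by (rule pr_suc)

lemma total_recursive_fst: "total_recursive (\<lambda>n. fst (prod_decode n))"
  unfolding total_recursive_def by (rule pr_fst)

lemma total_recursive_snd: "total_recursive (\<lambda>n. snd (prod_decode n))"
  unfolding total_recursive_def by (rule pr_snd)

lemma total_recursive_pair:
  assumes "total_recursive f" "total_recursive g"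
  shows "total_recursive (\<lambda>n. prod_encode (f n, g n))"
  using pr_pair[OF assms[unfolded total_recursive_def]] by (simp add: total_recursive_def)

lemma total_recursive_comp:
  assumes "total_recursive f" "total_recursive g"
  shows "total_recursive (\<lambda>n. f (g n))"
  using pr_comp[OF assms[unfolded total_recursive_def]] by (simp add: total_recursive_def)

lemma total_recursive_rec:
  assumes "total_recursive f" "total_recursive g"
  shows "total_recursive
    (\<lambda>n. rec_nat (f (fst (prod_decode n)))
           (\<lambda>k y. g (prod_encode (fst (prod_decode n), prod_encode (k, y))))
           (snd (prod_decode n)))"
proof -
  \<comment> \<open>With total functions no stage of the recursion is undefined, so recursion on
    options is ordinary recursion under \<open>Some\<close>.\<close>
  have "rec_nat (Some a) (\<lambda>k r. Option.bind r (\<lambda>y. Some (h k y))) n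
      = Some (rec_nat a h n)" for a :: nat and h n
    by (induction n) auto
  then show ?thesis
    using pr_rec[OF assms[unfolded total_recursive_def]] by (simp add: total_recursive_def)
qed

lemma total_recursive_const: "total_recursive (\<lambda>n. c)"
  by (induction c)
    (auto intro: total_recursive_zero total_recursive_comp[OF total_recursive_Suc])

lemma total_recursive_ident: "total_recursive (\<lambda>n. n)"
  using total_recursive_pair[OF total_recursive_fst total_recursive_snd] by simp

section \<open>Injective codes of typed data\<close>

class encodable =
  fixes enc :: "'a \<Rightarrow> nat"
  assumes enc_inject: "enc x = enc y \<longleftrightarrow> x = y"

instantiation nat :: encodable
begin
definition enc_nat :: "nat \<Rightarrow> nat" where "enc_nat n = n"
instance by standard (simp add: enc_nat_def)
end

instantiation prod :: (encodable, encodable) encodable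
begin
definition enc_prod :: "'a \<times> 'b \<Rightarrow> nat" where
  "enc_prod p = prod_encode (enc (fst p), enc (snd p))"
instance by standard (auto simp: enc_prod_def enc_inject prod_eq_iff)
end

instantiation list :: (encodable) encodable
begin
definition enc_list :: "'a list \<Rightarrow> nat" where
  "enc_list xs = list_encode (map enc xs)"
instance
  by standard (simp add: enc_list_def list_encode_eq inj_map_eq_map inj_on_def enc_inject)
end

lemma form_encode_inject: "form_encode A = form_encode B \<longleftrightarrow> A = B"
proof (induction A arbitrary: B)
  case (Var n) then show ?case by (cases B) auto
next
  case (And A1 A2) then show ?case by (cases B) auto
next
  case (Or A1 A2) then show ?case by (cases B) auto
next
  case (Imp A1 A2) then show ?case by (cases B) auto
next
  case (Neg A) then show ?case by (cases B) auto
qed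

instantiation form :: encodable
begin
definition enc_form :: "form \<Rightarrow> nat" where "enc_form = form_encode"
instance by standard (simp add: enc_form_def form_encode_inject)
end

lemma enc_Nil: "enc [] = 0"
  by (simp add: enc_list_def)

lemma enc_Cons: "enc (x # xs) = Suc (prod_encode (enc x, enc xs))"
  by (simp add: enc_list_def)

lemma enc_proof: "enc = proof_encode"
  by (rule ext)
    (simp add: proof_encode_def line_encode_def enc_list_def enc_prod_def enc_form_def
      cong: map_cong)

text \<open>Only the values on codes are prescribed; the numerical function may do anything
  elsewhere. At type \<open>line list\<close> the code is \<open>proof_encode\<close>, so
  computability of a translation can be proved compositionally on typed data and then read as a fact
  about encoded proofs.\<close>

definition computable :: "('a::encodable \<Rightarrow> 'b::encodable) \<Rightarrow> bool" where
  "computable f \<longleftrightarrow> (\<exists>g. total_recursive g \<and> (\<forall>x. g (enc x) = enc (f x)))"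

lemma computableI: "total_recursive g \<Longrightarrow> (\<And>x. g (enc x) = enc (f x)) \<Longrightarrow> computable f"
  unfolding computable_def by blast

lemma computable_const: "computable (\<lambda>x. c)"
  by (rule computableI[OF total_recursive_const]) simp

lemma computable_ident: "computable (\<lambda>x. x)"
  by (rule computableI[OF total_recursive_ident]) simp

lemma computable_comp:
  assumes "computable f" "computable g"
  shows "computable (\<lambda>x. f (g x))"
  using assms unfolding computable_def
  by (metis (mono_tags, lifting) total_recursive_comp)

lemma computable_Pair:
  assumes "computable f" "computable g"
  shows "computable (\<lambda>x. (f x, g x))"
proof -
  obtain f' g' where "total_recursive f'" "\<And>x. f' (enc x) = enc (f x)"
    "total_recursive g'" "\<And>x. g' (enc x) = enc (g x)"
    using assms unfolding computable_def by blast
  then show ?thesis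
    by (intro computableI[OF total_recursive_pair[of f' g']]) (auto simp: enc_prod_def)
qed

lemma computable_comp2:
  assumes "computable (\<lambda>p. h (fst p) (snd p))" "computable f" "computable g"
  shows "computable (\<lambda>x. h (f x) (g x))"
  using computable_comp[OF assms(1) computable_Pair[OF assms(2,3)]] by simp

lemma computable_fst: "computable f \<Longrightarrow> computable (\<lambda>x. fst (f x))"
  by (rule computable_comp[of fst], rule computableI[OF total_recursive_fst])
    (simp_all add: enc_prod_def)

lemma computable_snd: "computable f \<Longrightarrow> computable (\<lambda>x. snd (f x))"
  by (rule computable_comp[of snd], rule computableI[OF total_recursive_snd])
    (simp_all add: enc_prod_def)

lemma computable_Suc: "computable f \<Longrightarrow> computable (\<lambda>x. Suc (f x))"
  by (rule computable_comp[of Suc], rule computableI[OF total_recursive_Suc])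
    (simp_all add: enc_nat_def)

lemma computable_rec_nat:
  assumes "computable f" "computable (\<lambda>p. g (fst p) (fst (snd p)) (snd (snd p)))" "computable m"
  shows "computable (\<lambda>x. rec_nat (f x) (g x) (m x))"
proof -
  obtain f' g' m' where f': "total_recursive f'" "\<And>x. f' (enc x) = enc (f x)"
    and g': "total_recursive g'"
      "\<And>p. g' (enc p) = enc (g (fst p) (fst (snd p)) (snd (snd p)))"
    and m': "total_recursive m'" "\<And>x. m' (enc x) = enc (m x)"
    using assms unfolding computable_def by blast
  have "g' (prod_encode (enc x, prod_encode (k, enc y))) = enc (g x k y)" for x k y
    using g'(2)[of "(x, k, y)"] by (simp add: enc_prod_def enc_nat_def)
  then have "rec_nat (f' (enc x)) (\<lambda>k y. g' (prod_encode (enc x, prod_encode (k, y)))) n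
      = enc (rec_nat (f x) (g x) n)" for x n
    by (induction n) (auto simp: f'(2))
  then show ?thesis
    by (intro computableI[OF total_recursive_comp[OF total_recursive_rec[OF f'(1) g'(1)]
        total_recursive_pair[OF total_recursive_ident m'(1)]]]) (simp add: m'(2) enc_nat_def)
qed

lemma computable_if_zero:
  assumes "computable m" "computable f" "computable g"
  shows "computable (\<lambda>x. if m x = (0::nat) then f x else g x)"
proof -
  \<comment> \<open>A recursion step that ignores its argument acts as a case distinction on
    zero.\<close>
  have "rec_nat (f x) (\<lambda>k r. g x) n = (if n = 0 then f x else g x)" for x n
    by (cases n) auto
  then show ?thesis
    using computable_rec_nat[of f "\<lambda>x k r. g x", OF assms(2) _ assms(1)]
      computable_comp[OF assms(3) computable_fst[OF computable_ident]] by simp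
qed

lemma computable_diff:
  assumes "computable f" "computable g"
  shows "computable (\<lambda>x. f x - g x :: nat)"
proof -
  have pred: "computable (\<lambda>x. h x - 1 :: nat)" if "computable h" for h :: "'c::encodable \<Rightarrow> nat"
  proof -
    have "rec_nat 0 (\<lambda>k r. k) n = n - 1" for n :: nat by (cases n) auto
    then show ?thesis
      using computable_rec_nat[of "\<lambda>x. 0" "\<lambda>x k r. k", OF _ _ that]
      by (simp add: computable_const computable_fst computable_snd computable_ident)
  qed
  have "rec_nat m (\<lambda>k r. r - 1) n = m - n" for m n :: nat
    by (induction n) auto
  then show ?thesis
    using computable_rec_nat[of f "\<lambda>x k r. r - 1", OF assms(1) _ assms(2)]
    by (simp add: pred[unfolded One_nat_def] computable_snd computable_ident)
qed

text \<open>Codes are injective, so two values agree exactly when both truncated differences of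
  their codes vanish.\<close>

lemma computable_if_eq:
  fixes a b :: "'a::encodable \<Rightarrow> 'b::encodable"
  assumes "computable a" "computable b" "computable f" "computable g"
  shows "computable (\<lambda>x. if a x = b x then f x else g x)"
proof -
  have code: "computable (\<lambda>x. enc (h x))" if "computable h" for h :: "'a \<Rightarrow> 'b"
    using that unfolding computable_def enc_nat_def .
  have "(if enc (a x) - enc (b x) = 0 then if enc (b x) - enc (a x) = 0 then f x else g x
      else g x) = (if a x = b x then f x else g x)" for x
  proof (cases "a x = b x")
    case False
    then have "enc (a x) \<noteq> enc (b x)" by (simp add: enc_inject)
    then show ?thesis using False by auto
  qed simp
  moreover have "computable (\<lambda>x. if enc (a x) - enc (b x) = 0
      then if enc (b x) - enc (a x) = 0 then f x else g x else g x)"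
    by (intro computable_if_zero computable_diff code assms)
  ultimately show ?thesis by simp
qed

section \<open>Computable operations on lists\<close>

lemma computable_Cons:
  assumes "computable f" "computable g"
  shows "computable (\<lambda>x. f x # g x)"
proof (rule computable_comp2[OF _ assms])
  show "computable (\<lambda>p::'b \<times> 'b list. fst p # snd p)"
    by (rule computableI[OF total_recursive_Suc]) (simp add: enc_Cons enc_prod_def)
qed

text \<open>The empty list has code 0 and a nonempty one the successor of a pair, so a zero test and
  a projection recover head and tail. The value \<open>c\<close> at 0 is left open so that it can be
  the code of \<open>hd []\<close>.\<close>

lemma total_recursive_list_hd_tl:
  "total_recursive (\<lambda>n. if n = 0 then c else fst (prod_decode (n - 1)))"
  "total_recursive (\<lambda>n. if n = 0 then 0 else snd (prod_decode (n - 1)))"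
proof -
  have nat: "total_recursive f" if "computable f" for f :: "nat \<Rightarrow> nat"
    using that by (simp add: computable_def enc_nat_def) (metis ext)
  have dec: "computable prod_decode"
    by (rule computableI[OF total_recursive_ident])
      (metis enc_prod_def enc_nat_def prod.collapse prod_decode_inverse)
  note intros = nat computable_if_zero computable_fst computable_snd computable_comp[OF dec]
    computable_diff computable_ident computable_const
  show "total_recursive (\<lambda>n. if n = 0 then c else fst (prod_decode (n - 1)))" by (intro intros)
  show "total_recursive (\<lambda>n. if n = 0 then 0 else snd (prod_decode (n - 1)))" by (intro intros)
qed

lemma computable_hd: "computable f \<Longrightarrow> computable (\<lambda>x. hd (f x))"
proof (rule computable_comp[of hd])
  show "computable (hd :: 'b list \<Rightarrow> 'b)"
  proof (rule computableI[OF total_recursive_list_hd_tl(1)])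
    fix xs :: "'b list"
    show "(if enc xs = 0 then enc (hd [] :: 'b) else fst (prod_decode (enc xs - 1))) = enc (hd xs)"
      by (cases xs) (auto simp: enc_Nil enc_Cons)
  qed
qed

lemma computable_tl: "computable f \<Longrightarrow> computable (\<lambda>x. tl (f x))"
proof (rule computable_comp[of tl])
  show "computable (tl :: 'b list \<Rightarrow> 'b list)"
  proof (rule computableI[OF total_recursive_list_hd_tl(2)])
    fix xs :: "'b list"
    show "(if enc xs = 0 then 0 else snd (prod_decode (enc xs - 1))) = enc (tl xs)"
      by (cases xs) (auto simp: enc_Nil enc_Cons)
  qed
qed

lemma length_le_enc: "length xs \<le> enc xs"
proof (induction xs)
  case (Cons x xs)
  then show ?case using le_prod_encode_2[of "enc xs" "enc x"] by (simp add: enc_Cons)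
qed simp

text \<open>The code of a list bounds its length, so iterating the step that consumes the head of the
  list that many times runs through all of it.\<close>

lemma computable_foldl:
  assumes "computable (\<lambda>p. g (fst p) (snd p))" "computable s" "computable f"
  shows "computable (\<lambda>x. foldl g (s x) (f x))"
proof -
  define step where "step st = (if snd st = [] then st
    else (g (fst st) (hd (snd st)), tl (snd st)))" for st
  have iter: "fst ((step ^^ n) (a, xs)) = foldl g a xs" if "length xs \<le> n" for n a xs
    using that
  proof (induction n arbitrary: a xs)
    case (Suc n)
    then show ?case
    proof (cases xs)
      case Nil
      \<comment> \<open>An exhausted list leaves the state fixed, so iterating beyond the length of
        the list is harmless.\<close>
      have "(step ^^ m) (a, []) = (a, [])" for m by (induction m) (auto simp: step_def)
      then show ?thesis using Nil by (metis fst_conv foldl_Nil)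
    next
      case (Cons y ys)
      then show ?thesis using Suc by (simp add: funpow_Suc_right step_def del: funpow.simps)
    qed
  qed simp
  have funpow: "rec_nat a (\<lambda>k. step) n = (step ^^ n) a" for a n
    by (induction n) auto
  have "computable step"
    unfolding step_def[abs_def]
    by (intro computable_if_eq computable_snd computable_fst computable_ident computable_const
        computable_Pair computable_comp2[OF assms(1)] computable_hd computable_tl)
  moreover have "computable (\<lambda>x. enc (f x))"
    using assms(3) unfolding computable_def enc_nat_def .
  ultimately have "computable (\<lambda>x. rec_nat (s x, f x) (\<lambda>k. step) (enc (f x)))"
    using computable_rec_nat[of "\<lambda>x. (s x, f x)" "\<lambda>x k. step" "\<lambda>x. enc (f x)"]
      computable_comp[of step "\<lambda>p. snd (snd p)"] computable_Pair[OF assms(2,3)]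
    by (simp add: computable_snd computable_ident)
  from computable_fst[OF this] show ?thesis
    by (simp add: funpow iter length_le_enc)
qed

lemma computable_length: "computable f \<Longrightarrow> computable (\<lambda>x. length (f x))"
proof -
  assume "computable f"
  moreover have "foldl (\<lambda>n y. Suc n) m xs = m + length xs" for m and xs :: "'b list"
    by (induction xs arbitrary: m) auto
  ultimately show ?thesis
    using computable_foldl[of "\<lambda>n y. Suc n" "\<lambda>x. 0" f]
    by (simp add: computable_Suc computable_fst computable_ident computable_const)
qed

lemma computable_rev: "computable f \<Longrightarrow> computable (\<lambda>x. rev (f x))"
proof -
  assume "computable f"
  moreover have "foldl (\<lambda>ys y. y # ys) zs xs = rev xs @ zs" for zs xs :: "'b list"
    by (induction xs arbitrary: zs) auto
  ultimately show ?thesis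
    using computable_foldl[of "\<lambda>ys y. y # ys" "\<lambda>x. []" f]
    by (simp add: computable_Cons computable_snd computable_fst computable_ident computable_const)
qed

lemma computable_append:
  assumes "computable f" "computable g"
  shows "computable (\<lambda>x. f x @ g x)"
proof -
  have "foldl (\<lambda>ys y. y # ys) zs xs = rev xs @ zs" for zs xs :: "'b list"
    by (induction xs arbitrary: zs) auto
  then show ?thesis
    using computable_foldl[of "\<lambda>ys y. y # ys" g "\<lambda>x. rev (f x)"] assms
    by (simp add: computable_Cons computable_snd computable_fst computable_ident computable_rev)
qed

section \<open>Computable operations on formulas\<close>

lemma computable_Imp:
  assumes "computable f" "computable g"
  shows "computable (\<lambda>x. Imp (f x) (g x))"
proof (rule computable_comp2[OF _ assms])
  show "computable (\<lambda>p. Imp (fst p) (snd p))"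
    \<comment> \<open>The constant is the tag of the constructor in \<open>form_encode\<close>;
      likewise in the next three lemmas.\<close>
    by (rule computableI[OF total_recursive_pair[OF total_recursive_const[of 3]
        total_recursive_ident]]) (simp add: enc_prod_def enc_form_def)
qed

lemma computable_Or:
  assumes "computable f" "computable g"
  shows "computable (\<lambda>x. Or (f x) (g x))"
proof (rule computable_comp2[OF _ assms])
  show "computable (\<lambda>p. Or (fst p) (snd p))"
    by (rule computableI[OF total_recursive_pair[OF total_recursive_const[of 2]
        total_recursive_ident]]) (simp add: enc_prod_def enc_form_def)
qed

lemma computable_And:
  assumes "computable f" "computable g"
  shows "computable (\<lambda>x. And (f x) (g x))"
proof (rule computable_comp2[OF _ assms])
  show "computable (\<lambda>p. And (fst p) (snd p))"
    by (rule computableI[OF total_recursive_pair[OF total_recursive_const[of 1]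
        total_recursive_ident]]) (simp add: enc_prod_def enc_form_def)
qed

lemma computable_Neg: "computable f \<Longrightarrow> computable (\<lambda>x. Neg (f x))"
proof (rule computable_comp[of Neg])
  show "computable Neg"
    by (rule computableI[OF total_recursive_pair[OF total_recursive_const[of 4]
        total_recursive_ident]]) (simp add: enc_form_def)
qed

text \<open>The schema \<open>A\<close> is fixed, so induction on it unfolds the substitution into
  finitely many constructor applications. No recursion over encoded formulas is involved.\<close>

lemma computable_subst:
  assumes "\<And>n. computable (\<lambda>x. \<sigma> x n)"
  shows "computable (\<lambda>x. subst (\<sigma> x) A)"
  by (induction A)
    (auto intro: assms computable_And computable_Or computable_Imp computable_Neg)

lemma computable_map_Pair_subst:
  fixes c :: "'a::encodable \<Rightarrow> ctx"
  assumes "computable c" "\<And>n. computable (\<lambda>x. \<sigma> x n)"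
  shows "computable (\<lambda>x. map (Pair (c x)) (map (subst (\<sigma> x)) D))"
  by (induction D) (simp_all add: computable_const computable_Cons computable_Pair
      computable_subst assms del: map_map)

text \<open>The auxiliary derivations are fixed once, with conclusions in \<open>Var 0\<close> and
  \<open>Var 1\<close>. Any further variable occurring inside them is sent to \<open>B\<close> too,
  which does no harm since axiom instances are closed under substitution.\<close>

definition pair_subst :: "form \<Rightarrow> form \<Rightarrow> nat \<Rightarrow> form" where
  "pair_subst A B n = (if n = 0 then A else B)"

lemma computable_pair_subst:
  "computable f \<Longrightarrow> computable g \<Longrightarrow> computable (\<lambda>x. pair_subst (f x) (g x) n)"
  by (cases n) (simp_all add: pair_subst_def)

lemmas computable_intros = computable_const computable_ident computable_Pair computable_fst
  computable_snd computable_if_eq computable_Cons computable_hd computable_tl computable_length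
  computable_rev computable_append computable_Imp computable_Or computable_Neg
  computable_map_Pair_subst computable_pair_subst computable_Suc

section \<open>Derivations in the Frege system\<close>

text \<open>\<open>H\<close> holds formulas that modus ponens may use without their being lines of
  the list. They stand for lines already available at the place of a nested proof where the
  derivation is inserted.\<close>

inductive derivation :: "form set \<Rightarrow> form set \<Rightarrow> form list \<Rightarrow> bool" for F H where
  derivation_Nil: "derivation F H []"
| derivation_axiom: "derivation F H D \<Longrightarrow> axiom_instance F A \<Longrightarrow> derivation F H (D @ [A])"
| derivation_mp: "\<lbrakk>derivation F H D; A \<in> H \<union> set D; Imp A B \<in> H \<union> set D\<rbrakk>
    \<Longrightarrow> derivation F H (D @ [B])"

lemma derivation_append:
  assumes "derivation F H D" "derivation F H E"
  shows "derivation F H (D @ E)"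
  using assms(2)
proof induction
  case (derivation_mp E A B)
  then show ?case using derivation.derivation_mp[of F H "D @ E" A B] by auto
qed (use assms(1) derivation_axiom in \<open>auto simp flip: append_assoc\<close>)

lemma derivation_weaken: "derivation F {} D \<Longrightarrow> derivation F H D"
  by (induction rule: derivation.induct) (auto intro: derivation.intros)

lemma frege_provable_derivation:
  "frege_provable F A \<Longrightarrow> \<exists>D. derivation F {} D \<and> A \<in> set D"
proof (induction rule: frege_provable.induct)
  case (ax A)
  then show ?case using derivation_axiom[OF derivation_Nil, of F A "{}"] by force
next
  case (mp A B)
  then obtain D E where "derivation F {} D" "A \<in> set D" "derivation F {} E" "Imp A B \<in> set E"
    by blast
  then have "derivation F {} ((D @ E) @ [B])"
    by (intro derivation_mp[of _ _ _ A] derivation_append) auto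
  then show ?case by (metis in_set_conv_decomp)
qed

lemma subst_subst: "subst \<sigma> (subst \<tau> A) = subst (\<lambda>n. subst \<sigma> (\<tau> n)) A"
  by (induction A) auto

lemma axiom_instance_subst: "axiom_instance F A \<Longrightarrow> axiom_instance F (subst \<sigma> A)"
  unfolding axiom_instance_def using subst_subst by blast

lemma derivation_subst: "derivation F {} D \<Longrightarrow> derivation F {} (map (subst \<sigma>) D)"
proof (induction rule: derivation.induct)
  case (derivation_mp D A B)
  then show ?case
    using derivation.derivation_mp[of F "{}" "map (subst \<sigma>) D" "subst \<sigma> A" "subst \<sigma> B"]
    by force
qed (auto intro: derivation.intros axiom_instance_subst)

lemma classical_frege_system_derivation:
  assumes "classical_frege_system F" "tautology A"
  shows "\<exists>D. derivation F {} D \<and> A \<in> set D"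
  using assms frege_provable_derivation unfolding classical_frege_system_def by blast

lemma classical_frege_system_or_elim:
  assumes "classical_frege_system F"
  shows "axiom_instance F (or_elim_schema A B C)"
proof -
  obtain a b c where "distinct [a, b, c]" "or_elim_schema (Var a) (Var b) (Var c) \<in> F"
    using assms unfolding classical_frege_system_def by blast
  moreover from this have "or_elim_schema A B C
      = subst (Var(a := A, b := B, c := C)) (or_elim_schema (Var a) (Var b) (Var c))"
    by (auto simp: or_elim_schema_def)
  ultimately show ?thesis unfolding axiom_instance_def by blast
qed

section \<open>Open blocks and available lines\<close>

lemma current_ctx_snoc [simp]: "current_ctx (P @ [l]) = fst l"
  by (simp add: current_ctx_def)

lemma current_ctx_append_derivation [simp]:
  "current_ctx (P @ map (Pair (current_ctx P)) D) = current_ctx P"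
  by (cases D rule: rev_cases) (auto simp: current_ctx_def)

lemma available_append: "available P U \<Gamma> A \<Longrightarrow> available (P @ Q) U \<Gamma> A"
  unfolding available_def by (metis length_append nth_append trans_less_add1)

lemma available_new:
  assumes "(\<Delta>, A) \<in> set Q" "prefix \<Delta> \<Gamma>" "U \<subseteq> {..<length P}"
  shows "available (P @ Q) U \<Gamma> A"
proof -
  obtain i where "i < length Q" "Q ! i = (\<Delta>, A)"
    using assms(1) by (meson in_set_conv_nth)
  then show ?thesis
    unfolding available_def using assms(2,3)
    by (intro exI[of _ "length P + i"]) (auto simp: nth_append)
qed

text \<open>Positions from \<open>t\<close> on do not matter for the first \<open>t\<close> lines,
  so these keep their availability when the proof grows or a block starting at \<open>t\<close> or
  later is closed.\<close>

lemma available_take_mono: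
  assumes "available (take t P) U \<Gamma> A" "U' \<inter> {..<t} \<subseteq> U" "t \<le> length P"
  shows "available (take t (P @ Q)) U' \<Gamma> A"
proof -
  obtain j where "j < t" "j \<notin> U" "prefix (fst (P ! j)) \<Gamma>" "snd (P ! j) = A"
    using assms(1,3) by (auto simp: available_def)
  then show ?thesis
    unfolding available_def using assms(2,3) by (intro exI[of _ j]) auto
qed

text \<open>\<open>T\<close> lists the start positions of the blocks opened by the assumptions in the context, and no
  line written since the start of a block lies outside that block.\<close>

fun open_blocks :: "line list \<Rightarrow> nat list \<Rightarrow> ctx \<Rightarrow> bool" where
  "open_blocks P [] \<Gamma> \<longleftrightarrow> \<Gamma> = []"
| "open_blocks P (t # T) \<Gamma> \<longleftrightarrow> (\<exists>\<Delta> A. \<Gamma> = \<Delta> @ [A] \<and> t < length P \<and> P ! t = (\<Gamma>, A) \<and>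
     (\<forall>m. t \<le> m \<longrightarrow> m < length P \<longrightarrow> length \<Gamma> \<le> length (fst (P ! m))) \<and> open_blocks P T \<Delta>)"

lemma open_blocks_snoc:
  "open_blocks P T \<Gamma> \<Longrightarrow> length \<Gamma> \<le> length (fst l) \<Longrightarrow> open_blocks (P @ [l]) T \<Gamma>"
proof (induction T arbitrary: \<Gamma>)
  case (Cons t T)
  then obtain \<Delta> A where "\<Gamma> = \<Delta> @ [A]" "t < length P" "P ! t = (\<Gamma>, A)" "open_blocks P T \<Delta>"
    "\<forall>m. t \<le> m \<longrightarrow> m < length P \<longrightarrow> length \<Gamma> \<le> length (fst (P ! m))" by auto
  with Cons show ?case by (auto simp: nth_append less_Suc_eq)
qed simp

lemma open_blocks_less: "open_blocks P T \<Gamma> \<Longrightarrow> t \<in> set T \<Longrightarrow> t < length P"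
  by (induction T arbitrary: \<Gamma>) auto

text \<open>Closing the innermost block affects only positions from its start on, and all other open
  blocks start earlier. Hence the assumption line of an open block is never closed.\<close>

lemma nd_lines_open_blocks:
  "nd_lines F P S U \<Longrightarrow>
     open_blocks P S (current_ctx P) \<and> sorted_wrt (>) S \<and> U \<subseteq> {..<length P} \<and> set S \<inter> U = {}"
proof (induction rule: nd_lines.induct)
  case nd_empty
  show ?case by (simp add: current_ctx_def)
next
  case (nd_assume P S U A)
  then show ?case
    by (auto intro: open_blocks_snoc dest: open_blocks_less simp: nth_append less_Suc_eq)
next
  case (nd_deduction P i S U \<Gamma> A B)
  then have "P \<noteq> []" by auto
  with nd_deduction have "open_blocks P S \<Gamma>" by (auto simp: current_ctx_def)
  with nd_deduction show ?case by (auto intro: open_blocks_snoc)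
qed (auto intro: open_blocks_snoc)

text \<open>Every rule that closes a block also writes a line after it. So the last line is never
  closed and can serve as a premise, hence the bound \<open>length P - 1\<close>.\<close>

lemma no_lines_closed_bound: "no_lines F P S U \<Longrightarrow> U \<subseteq> {..<length P - 1}"
  by (induction rule: no_lines.induct) force+

text \<open>Inserting a Frege derivation in the current context changes neither the open nor the
  closed blocks: all closed positions lie below \<open>length P\<close>, so the inserted lines are
  available to one another.\<close>

lemma nd_lines_derivation:
  assumes "nd_lines F P S U" "\<And>A. A \<in> H \<Longrightarrow> available P U (current_ctx P) A" "derivation F H D"
  shows "nd_lines F (P @ map (Pair (current_ctx P)) D) S U"
  using assms(3)
proof induction
  case derivation_Nil
  show ?case using assms(1) by simp
next
  case (derivation_axiom D A)
  from nd_axiom[OF this(3,2)] show ?case by simp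
next
  case (derivation_mp D A B)
  have "available (P @ map (Pair (current_ctx P)) D) U (current_ctx P) X"
    if "X \<in> H \<union> set D" for X
    using that nd_lines_open_blocks[OF assms(1)] assms(2)
    by (auto intro: available_append available_new[where \<Delta> = "current_ctx P"])
  with nd_mp[OF derivation_mp(4), of A B] derivation_mp(2,3) show ?case by simp
qed

lemma no_lines_derivation:
  assumes "no_lines F P S U" "\<And>A. A \<in> H \<Longrightarrow> available P U (current_ctx P) A" "derivation F H D"
  shows "no_lines F (P @ map (Pair (current_ctx P)) D) S U"
  using assms(3)
proof induction
  case derivation_Nil
  show ?case using assms(1) by simp
next
  case (derivation_axiom D A)
  from no_axiom[OF this(3,2)] show ?case by simp
next
  case (derivation_mp D A B)
  have "available (P @ map (Pair (current_ctx P)) D) U (current_ctx P) X"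
    if "X \<in> H \<union> set D" for X
    using that no_lines_closed_bound[OF assms(1)] assms(2)
    by (force intro: available_append available_new[where \<Delta> = "current_ctx P"])
  with no_mp[OF derivation_mp(4), of A B] derivation_mp(2,3) show ?case by simp
qed

section \<open>Line-by-line translations\<close>

text \<open>Besides the output, the translation keeps the previous line and the stack of the assumptions
  that opened the current blocks; for a pair of blocks it is the first assumption that is kept.\<close>

type_synonym state = "form list \<times> line \<times> line list"

text \<open>The length of the context tells what happens to the blocks: one longer opens a block,
  shorter closes one. Opening the second block of a pair keeps the length, so the first assumption
  stays on the stack. The parameter \<open>c\<close> sees the stack and the line from before the
  current line.\<close>

definition step :: "(form list \<times> line \<times> line \<Rightarrow> line list) \<Rightarrow> state \<Rightarrow> line \<Rightarrow> state" where
  "step c s l =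
    ((if length (fst l) = Suc (length (fst (fst (snd s)))) then snd l # fst s
      else if length (fst l) = length (fst (fst (snd s))) then fst s else tl (fst s)),
     l, snd (snd s) @ c (fst s, fst (snd s), l))"

definition run :: "(form list \<times> line \<times> line \<Rightarrow> line list) \<Rightarrow> line list \<Rightarrow> state" where
  "run c P = foldl (step c) ([], ([], Var 0), []) P"

text \<open>Before the first line the context is empty, as for \<open>current_ctx\<close>;
  \<open>Var 0\<close> is only a placeholder.\<close>

definition previous :: "line list \<Rightarrow> line" where
  "previous P = (if P = [] then ([], Var 0) else last P)"

definition stack :: "(form list \<times> line \<times> line \<Rightarrow> line list) \<Rightarrow> line list \<Rightarrow> form list" where
  "stack c P = fst (run c P)"

definition translation :: "(form list \<times> line \<times> line \<Rightarrow> line list) \<Rightarrow> line list \<Rightarrow> line list" where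
  "translation c P = snd (snd (run c P))"

lemma fst_previous [simp]: "fst (previous P) = current_ctx P"
  by (simp add: previous_def current_ctx_def)

lemma previous_run: "fst (snd (run c P)) = previous P"
  by (cases P rule: rev_cases) (auto simp: run_def step_def previous_def)

lemma translation_Nil [simp]: "translation c [] = []"
  by (simp add: translation_def run_def)

lemma translation_snoc [simp]: "translation c (P @ [l]) = translation c P @ c (stack c P, previous P, l)"
  using previous_run[of c P] by (simp add: translation_def stack_def run_def step_def)

lemma stack_Nil [simp]: "stack c [] = []"
  by (simp add: stack_def run_def)

lemma stack_snoc: "stack c (P @ [l]) =
    (if length (fst l) = Suc (length (current_ctx P)) then snd l # stack c P
     else if length (fst l) = length (current_ctx P) then stack c P else tl (stack c P))"
  using previous_run[of c P] by (simp add: stack_def run_def step_def)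

lemma computable_translation:
  assumes "computable c"
  shows "computable (translation c)"
proof -
  have "computable (\<lambda>p. step c (fst p) (snd p))"
    unfolding step_def by (intro computable_intros computable_comp[OF assms])
  then have "computable (\<lambda>P. snd (snd (foldl (step c) ([], ([], Var 0), []) P)))"
    by (intro computable_snd computable_foldl computable_const computable_ident)
  then show ?thesis by (simp add: translation_def[abs_def] run_def)
qed

lemma length_translation: "(\<And>x. length (c x) \<le> b) \<Longrightarrow> length (translation c P) \<le> b * length P"
proof (induction P rule: rev_induct)
  case (snoc l P)
  show ?case
    using snoc.IH[OF snoc.prems] snoc.prems[of "(stack c P, previous P, l)"] by simp
qed simp

text \<open>Reduces a simulation to a computable translation of single lines, a uniform bound on its
  output, which becomes the linear factor, and correctness of the result.\<close>

lemma linearly_simulates_translation: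
  assumes "computable c" "\<And>x. length (c x) \<le> b"
    and "\<And>P A. P_proof P A \<Longrightarrow> Q_proof (translation c P) A"
  shows "linearly_simulates Q_proof P_proof"
proof -
  obtain g where "total_recursive g" "\<And>P. g (enc P) = enc (translation c P)"
    using computable_translation[OF assms(1)] unfolding computable_def by blast
  then show ?thesis
    unfolding linearly_simulates_def total_recursive_def enc_proof
    using assms(3) length_translation[of c b, OF assms(2)] by blast
qed

text \<open>\<open>h\<close> sends the position of a line to the position of its copy in the translation.\<close>

definition embeds :: "(nat \<Rightarrow> nat) \<Rightarrow> line list \<Rightarrow> line list \<Rightarrow> bool" where
  "embeds h P Q \<longleftrightarrow> (\<forall>i < length P. h i < length Q \<and> Q ! h i = P ! i) \<and>
     (\<forall>i j. i < j \<longrightarrow> j < length P \<longrightarrow> h i < h j) \<and>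
     (P = [] \<longleftrightarrow> Q = []) \<and> (P \<noteq> [] \<longrightarrow> last Q = last P)"

lemma embeds_current_ctx: "embeds h P Q \<Longrightarrow> current_ctx Q = current_ctx P"
  by (auto simp: embeds_def current_ctx_def)

text \<open>\<open>R\<close> consists of the auxiliary lines written before the copy of
  \<open>l\<close>. Since the copy comes last, both proofs end in the same line and context after
  each step.\<close>

lemma embeds_snoc:
  "embeds h P Q \<Longrightarrow> embeds (h(length P := length Q + length R)) (P @ [l]) (Q @ R @ [l])"
  by (auto simp: embeds_def nth_append less_Suc_eq trans_less_add1)

lemma available_embeds:
  assumes "embeds h P Q" "\<And>i. i < length P \<Longrightarrow> i \<notin> U \<Longrightarrow> h i \<notin> V" "available P U \<Gamma> A"
  shows "available Q V \<Gamma> A"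
  using assms unfolding available_def embeds_def by metis

section \<open>From nested deduction to nested disjunction\<close>

text \<open>The parameters are derivations of \<open>p \<or> \<not> p\<close>, \<open>q \<supset> (p \<supset> q)\<close> and \<open>\<not> p \<supset> (p \<supset> q)\<close>.\<close>

definition nd_to_no ::
  "form list \<Rightarrow> form list \<Rightarrow> form list \<Rightarrow> form list \<times> line \<times> line \<Rightarrow> line list" where
  "nd_to_no D0 D1 D2 x =
    (let \<Gamma> = fst (fst (snd x)); Y = snd (fst (snd x)); \<Delta> = fst (snd (snd x));
         X = snd (snd (snd x)); A = hd (rev \<Gamma>) in
     if length \<Delta> = Suc (length \<Gamma>) then
       map (Pair \<Gamma>) (map (subst (pair_subst X X)) D0) @ [(\<Delta>, X)]
     else if length \<Delta> = length \<Gamma> then [(\<Delta>, X)]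
     else
       map (Pair \<Gamma>) (map (subst (pair_subst A Y)) D1) @
       [(\<Gamma>, X), (\<Delta> @ [Neg A], Neg A)] @
       map (Pair (\<Delta> @ [Neg A])) (map (subst (pair_subst A Y)) D2) @
       [(\<Delta> @ [Neg A], X), (\<Delta>, X)])"

lemma computable_nd_to_no: "computable (nd_to_no D0 D1 D2)"
  unfolding nd_to_no_def[abs_def] Let_def by (intro computable_intros)

lemma length_nd_to_no: "length (nd_to_no D0 D1 D2 x) \<le> length D0 + length D1 + length D2 + 4"
  by (simp add: nd_to_no_def Let_def)

text \<open>Excluded middle is derived before the block opens, because the later disjunction
  elimination needs it in the outer context.\<close>

lemma nd_to_no_grow:
  "length \<Delta> = Suc (length (fst p)) \<Longrightarrow> nd_to_no D0 D1 D2 (k, p, (\<Delta>, X)) =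
     map (Pair (fst p)) (map (subst (pair_subst X X)) D0) @ [(\<Delta>, X)]"
  by (simp add: nd_to_no_def)

lemma nd_to_no_same:
  "length \<Delta> = length (fst p) \<Longrightarrow> nd_to_no D0 D1 D2 (k, p, (\<Delta>, X)) = [(\<Delta>, X)]"
  by (simp add: nd_to_no_def)

text \<open>In \<open>nd_lines\<close> the context shrinks only when the deduction rule closes a
  block, so \<open>X\<close> is then \<open>Imp A B\<close>. It follows from \<open>B\<close> in the
  block of \<open>A\<close>, by way of \<open>D1\<close>, and from \<open>Neg A\<close> in a second
  block, by way of \<open>D2\<close>.\<close>

lemma nd_to_no_shrink:
  "nd_to_no D0 D1 D2 (k, (\<Gamma> @ [A], B), (\<Gamma>, X)) =
     map (Pair (\<Gamma> @ [A])) (map (subst (pair_subst A B)) D1) @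
     [(\<Gamma> @ [A], X), (\<Gamma> @ [Neg A], Neg A)] @
     map (Pair (\<Gamma> @ [Neg A])) (map (subst (pair_subst A B)) D2) @
     [(\<Gamma> @ [Neg A], X), (\<Gamma>, X)]"
  by (simp add: nd_to_no_def Let_def)

lemma no_lines_case_split:
  assumes lines: "no_lines F Q (First t # T) V"
    and assumption: "Q ! t = (\<Gamma> @ [A], A)" and conclusion: "last Q = (\<Gamma> @ [A], B)"
    and t: "t < length Q" and em: "available (take t Q) V \<Gamma> (Or A (Neg A))"
    and D: "derivation F {} D" "Imp B (Imp A B) \<in> set D"
    and E: "derivation F {} E" "Imp (Neg A) (Imp A B) \<in> set E"
  shows "\<exists>V'. V' \<inter> {..<t} \<subseteq> V \<and> no_lines F
    (Q @ map (Pair (\<Gamma> @ [A])) D @ [(\<Gamma> @ [A], Imp A B), (\<Gamma> @ [Neg A], Neg A)] @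
      map (Pair (\<Gamma> @ [Neg A])) E @ [(\<Gamma> @ [Neg A], Imp A B), (\<Gamma>, Imp A B)]) T V'"
proof -
  have ctx: "current_ctx Q = \<Gamma> @ [A]" and "Q \<noteq> []"
    using t conclusion by (auto simp: current_ctx_def)
  have V: "V \<subseteq> {..<length Q - 1}" using no_lines_closed_bound[OF lines] .
  define R where "R = map (Pair (\<Gamma> @ [A])) (D @ [Imp A B])"
  have "available Q V (\<Gamma> @ [A]) B"
    unfolding available_def using V conclusion \<open>Q \<noteq> []\<close>
    by (intro exI[of _ "length Q - 1"]) (auto simp: last_conv_nth)
  moreover have "derivation F {B} (D @ [Imp A B])"
    using derivation_mp[OF derivation_weaken[OF D(1)], of B "{B}"] D(2) by auto
  ultimately have "no_lines F (Q @ R) (First t # T) V"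
    using no_lines_derivation[OF lines, of "{B}" "D @ [Imp A B]"] by (simp add: R_def ctx)
  moreover have "current_ctx (Q @ R) = \<Gamma> @ [A]"
    by (simp add: R_def current_ctx_def)
  ultimately have second: "no_lines F ((Q @ R) @ [(\<Gamma> @ [Neg A], Neg A)])
      (Second t (length (Q @ R)) # T) (V \<union> {t..<length (Q @ R)})" (is "no_lines F ?Q2 _ ?V2")
    by (rule no_assume_second)
  define R' where "R' = map (Pair (\<Gamma> @ [Neg A])) (E @ [Imp A B])"
  have "available ?Q2 ?V2 (\<Gamma> @ [Neg A]) (Neg A)"
    using V t by (intro available_new[of "\<Gamma> @ [Neg A]"]) auto
  moreover have "derivation F {Neg A} (E @ [Imp A B])"
    using derivation_mp[OF derivation_weaken[OF E(1)], of "Neg A" "{Neg A}"] E(2) by auto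
  ultimately have "no_lines F (?Q2 @ R') (Second t (length (Q @ R)) # T) ?V2"
    using no_lines_derivation[OF second, of "{Neg A}" "E @ [Imp A B]"]
    by (simp add: R'_def current_ctx_def)
  moreover have "available (?Q2 @ R') ?V2 \<Gamma> (Or A (Neg A))"
  proof -
    obtain j where "j < t" "j \<notin> V" "prefix (fst (Q ! j)) \<Gamma>" "snd (Q ! j) = Or A (Neg A)"
      using em t by (auto simp: available_def)
    then show ?thesis
      using t by (auto simp: available_def nth_append intro!: exI[of _ j])
  qed
  moreover have "(?Q2 @ R') ! t = (\<Gamma> @ [A], A)"
    using t assumption by (simp add: nth_append)
  moreover have "(?Q2 @ R') ! (length (Q @ R) - 1) = (\<Gamma> @ [A], Imp A B)"
    by (simp add: R_def nth_append)
  moreover have "(?Q2 @ R') ! length (Q @ R) = (\<Gamma> @ [Neg A], Neg A)"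
    by (simp add: nth_append)
  moreover have "last (?Q2 @ R') = (\<Gamma> @ [Neg A], Imp A B)"
    by (simp add: R'_def)
  ultimately have "no_lines F ((?Q2 @ R') @ [(\<Gamma>, Imp A B)]) T
      (?V2 \<union> {length (Q @ R)..<length (?Q2 @ R')})"
    by (rule no_or_elim)
  then show ?thesis
    using t by (intro exI[of _ "?V2 \<union> {length (Q @ R)..<length (?Q2 @ R')}"])
      (auto simp: R_def R'_def)
qed

text \<open>Live lines must have live copies; the converse is not asked for. For each open block the
  excluded middle is located before the copy of its start, where closing that block or an inner one
  cannot affect it.\<close>

definition nd_to_no_inv where
  "nd_to_no_inv h P S U Q V \<longleftrightarrow> embeds h P Q \<and> (\<forall>i < length P. i \<notin> U \<longrightarrow> h i \<notin> V) \<and>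
     (\<forall>i \<in> set S. i < length P \<and>
        (\<exists>\<Gamma> A. P ! i = (\<Gamma> @ [A], A) \<and> available (take (h i) Q) V \<Gamma> (Or A (Neg A))))"

text \<open>Serves every rule: open blocks are kept or dropped here, and a newly opened block is
  added afterwards. Newly closed positions must avoid copies of live lines and everything before a
  surviving block.\<close>

lemma nd_to_no_inv_snoc:
  assumes inv: "nd_to_no_inv h P S U Q V"
    and S: "set S' \<subseteq> set S" and V': "length Q + length R \<notin> V'"
    and live: "\<And>i. i < length P \<Longrightarrow> i \<notin> U' \<Longrightarrow> i \<notin> U \<and> (h i \<in> V' \<longrightarrow> h i \<in> V)"
    and em: "\<And>i. i \<in> set S' \<Longrightarrow> V' \<inter> {..<h i} \<subseteq> V"
  shows "nd_to_no_inv (h(length P := length Q + length R)) (P @ [l]) S' U' (Q @ R @ [l]) V'"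
proof -
  let ?h = "h(length P := length Q + length R)"
  note I = inv[unfolded nd_to_no_inv_def]
  have blocks: "i < length (P @ [l]) \<and> (\<exists>\<Gamma> A. (P @ [l]) ! i = (\<Gamma> @ [A], A) \<and>
      available (take (?h i) (Q @ R @ [l])) V' \<Gamma> (Or A (Neg A)))" if "i \<in> set S'" for i
  proof -
    have "i \<in> set S" using that S by (rule rev_subsetD)
    with I obtain \<Gamma> A where i: "i < length P" "P ! i = (\<Gamma> @ [A], A)"
      "available (take (h i) Q) V \<Gamma> (Or A (Neg A))" by metis
    have hi: "h i < length Q" using I i(1) by (simp add: embeds_def)
    have "?h i = h i" using i(1) by simp
    moreover have "available (take (h i) (Q @ R @ [l])) V' \<Gamma> (Or A (Neg A))"
      using available_take_mono[OF i(3) em[OF that]] hi by simp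
    ultimately show ?thesis
      using i(1,2) by (intro conjI exI[of _ \<Gamma>] exI[of _ A]) 
        (simp_all add: nth_append del: fun_upd_apply take_append)
  qed
  have "?h i \<notin> V'" if "i < length (P @ [l])" "i \<notin> U'" for i
  proof (cases "i = length P")
    case False
    then have "i < length P" using that(1) by simp
    then have "h i \<notin> V'" using I live that(2) by metis
    with False show ?thesis by simp
  qed (use V' in simp)
  with blocks show ?thesis
    unfolding nd_to_no_inv_def using embeds_snoc[OF conjunct1[OF I], of R l]
    by (intro conjI ballI allI impI) metis+
qed

text \<open>Induction over the rules. A second block is opened and closed within the translation of
  one line, so between lines every open block is a first block, starting at the copy of the original
  assumption.\<close>

lemma nd_to_no_simulation:
  assumes D0: "derivation F {} D0" "Or (Var 0) (Neg (Var 0)) \<in> set D0"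
    and D1: "derivation F {} D1" "Imp (Var 1) (Imp (Var 0) (Var 1)) \<in> set D1"
    and D2: "derivation F {} D2" "Imp (Neg (Var 0)) (Imp (Var 0) (Var 1)) \<in> set D2"
    and "nd_lines F P S U"
  shows "\<exists>h V. no_lines F (translation (nd_to_no D0 D1 D2) P) (map (\<lambda>i. First (h i)) S) V \<and>
    nd_to_no_inv h P S U (translation (nd_to_no D0 D1 D2) P) V"
  using assms(7)
proof induction
  case nd_empty
  show ?case
    by (auto simp: nd_to_no_inv_def embeds_def intro!: exI no_empty)
next
  case (nd_axiom P S U A)
  let ?Q = "translation (nd_to_no D0 D1 D2) P"
  obtain h V where no: "no_lines F ?Q (map (\<lambda>i. First (h i)) S) V"
    and inv: "nd_to_no_inv h P S U ?Q V" using nd_axiom by blast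
  have ctx: "current_ctx ?Q = current_ctx P"
    using inv embeds_current_ctx unfolding nd_to_no_inv_def by blast
  have "nd_to_no_inv (h(length P := length ?Q + length ([] :: line list))) (P @ [(current_ctx P, A)]) S U
      (?Q @ [] @ [(current_ctx P, A)]) V"
    using no_lines_closed_bound[OF no] by (intro nd_to_no_inv_snoc[OF inv]) auto
  moreover have "map (\<lambda>i. First ((h(length P := length ?Q)) i)) S = map (\<lambda>i. First (h i)) S"
    using inv by (auto simp: nd_to_no_inv_def)
  ultimately show ?case
    using no_axiom[OF no nd_axiom(2)]
    by (intro exI[of _ "h(length P := length ?Q)"] exI[of _ V])
      (simp add: nd_to_no_same ctx del: fun_upd_apply map_eq_conv)
next
  case (nd_mp P S U A B)
  let ?Q = "translation (nd_to_no D0 D1 D2) P"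
  obtain h V where no: "no_lines F ?Q (map (\<lambda>i. First (h i)) S) V"
    and inv: "nd_to_no_inv h P S U ?Q V" using nd_mp by blast
  have ctx: "current_ctx ?Q = current_ctx P"
    using inv embeds_current_ctx unfolding nd_to_no_inv_def by blast
  have av: "available ?Q V (current_ctx ?Q) X" if "available P U (current_ctx P) X" for X
    using inv available_embeds that unfolding nd_to_no_inv_def ctx by blast
  have "nd_to_no_inv (h(length P := length ?Q + length ([] :: line list))) (P @ [(current_ctx P, B)]) S U
      (?Q @ [] @ [(current_ctx P, B)]) V"
    using no_lines_closed_bound[OF no] by (intro nd_to_no_inv_snoc[OF inv]) auto
  moreover have "map (\<lambda>i. First ((h(length P := length ?Q)) i)) S = map (\<lambda>i. First (h i)) S"
    using inv by (auto simp: nd_to_no_inv_def)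
  ultimately show ?case
    using no_mp[OF no av[OF nd_mp(2)] av[OF nd_mp(3)]]
    by (intro exI[of _ "h(length P := length ?Q)"] exI[of _ V])
      (simp add: nd_to_no_same ctx del: fun_upd_apply map_eq_conv)
next
  case (nd_assume P S U A)
  let ?Q = "translation (nd_to_no D0 D1 D2) P"
  obtain h V where no: "no_lines F ?Q (map (\<lambda>i. First (h i)) S) V"
    and inv: "nd_to_no_inv h P S U ?Q V" using nd_assume by blast
  have ctx: "current_ctx ?Q = current_ctx P"
    using inv embeds_current_ctx unfolding nd_to_no_inv_def by blast
  define E where "E = map (subst (pair_subst A A)) D0"
  define R where "R = map (Pair (current_ctx ?Q)) E"
  let ?l = "(current_ctx P @ [A], A)" and ?h = "h(length P := length ?Q + length R)"
  have "derivation F {} E"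
    unfolding E_def by (rule derivation_subst[OF D0(1)])
  from no_lines_derivation[OF no _ this]
  have "no_lines F (?Q @ R) (map (\<lambda>i. First (h i)) S) V" by (simp add: R_def)
  from no_assume[OF this, of A]
  have "no_lines F (?Q @ R @ [?l]) (First (length ?Q + length R) # map (\<lambda>i. First (h i)) S) V"
    by (simp add: R_def ctx[symmetric])
  moreover have "map (\<lambda>i. First (?h i)) S = map (\<lambda>i. First (h i)) S"
    using inv by (auto simp: nd_to_no_inv_def)
  ultimately have no': "no_lines F (?Q @ R @ [?l]) (map (\<lambda>i. First (?h i)) (length P # S)) V"
    by (simp del: map_eq_conv)
  have V: "V \<subseteq> {..<length ?Q}" using no_lines_closed_bound[OF no] by auto
  then have "nd_to_no_inv ?h (P @ [?l]) S U (?Q @ R @ [?l]) V"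
    by (intro nd_to_no_inv_snoc[OF inv]) auto
  moreover have "Or A (Neg A) \<in> set E"
    using D0(2) unfolding E_def by (force simp: pair_subst_def)
  then have "available (?Q @ R) V (current_ctx P) (Or A (Neg A))"
    using V by (intro available_new[where \<Delta> = "current_ctx P"]) (auto simp: R_def ctx)
  \<comment> \<open>The copy of the assumption is at position \<open>length ?Q + length R\<close>,
    so the segment before it is exactly \<open>?Q @ R\<close>.\<close>
  then have "available (take (?h (length P)) (?Q @ R @ [?l])) V (current_ctx P) (Or A (Neg A))"
    by simp
  ultimately have "nd_to_no_inv ?h (P @ [?l]) (length P # S) U (?Q @ R @ [?l]) V"
    unfolding nd_to_no_inv_def by (auto simp del: fun_upd_apply take_append)
  moreover have "translation (nd_to_no D0 D1 D2) (P @ [?l]) = ?Q @ R @ [?l]"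
    by (simp add: nd_to_no_grow R_def E_def ctx)
  ultimately show ?case using no' by metis
next
  case (nd_deduction P i S U \<Gamma> A B)
  let ?Q = "translation (nd_to_no D0 D1 D2) P"
  obtain h V where no: "no_lines F ?Q (map (\<lambda>i. First (h i)) (i # S)) V"
    and inv: "nd_to_no_inv h P (i # S) U ?Q V" using nd_deduction by blast
  have emb: "embeds h P ?Q" using inv by (simp add: nd_to_no_inv_def)
  have i: "i < length P" "h i < length ?Q" "?Q ! h i = (\<Gamma> @ [A], A)"
    using inv emb nd_deduction(2) by (auto simp: nd_to_no_inv_def embeds_def)
  have em: "available (take (h i) ?Q) V \<Gamma> (Or A (Neg A))"
    using inv nd_deduction(2) by (auto simp: nd_to_no_inv_def)
  have "P \<noteq> []" using i by auto
  then have last: "last ?Q = (\<Gamma> @ [A], B)" "previous P = (\<Gamma> @ [A], B)"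
    using emb nd_deduction(3) by (auto simp: embeds_def previous_def)
  let ?s = "subst (pair_subst A B)"
  define R where "R = map (Pair (\<Gamma> @ [A])) (map ?s D1) @
     [(\<Gamma> @ [A], Imp A B), (\<Gamma> @ [Neg A], Neg A)] @
     map (Pair (\<Gamma> @ [Neg A])) (map ?s D2) @ [(\<Gamma> @ [Neg A], Imp A B)]"
  let ?h = "h(length P := length ?Q + length R)"
  have "Imp B (Imp A B) \<in> set (map ?s D1)" "Imp (Neg A) (Imp A B) \<in> set (map ?s D2)"
    using D1(2) D2(2) by (force simp: pair_subst_def)+
  then obtain V' where V': "V' \<inter> {..<h i} \<subseteq> V"
    and no': "no_lines F (?Q @ R @ [(\<Gamma>, Imp A B)]) (map (\<lambda>i. First (h i)) S) V'"
    using no_lines_case_split[OF no[simplified] i(3) last(1) i(2) em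
        derivation_subst[OF D1(1)] _ derivation_subst[OF D2(1)], of "pair_subst A B" "pair_subst A B"]
    by (auto simp: R_def)
  \<comment> \<open>Surviving blocks start before \<open>i\<close>, so their copies lie before
    \<open>h i\<close>, where \<open>V'\<close> closes nothing new.\<close>
  have S: "j < i" if "j \<in> set S" for j
    using nd_lines_open_blocks[OF nd_deduction(1)] that by auto
  have mono: "h j < h i" if "j < i" for j
    using emb that i(1) unfolding embeds_def by blast
  have "nd_to_no_inv ?h (P @ [(\<Gamma>, Imp A B)]) S (U \<union> {i..<length P})
      (?Q @ R @ [(\<Gamma>, Imp A B)]) V'"
  proof (rule nd_to_no_inv_snoc[OF inv])
    show "length ?Q + length R \<notin> V'" using no_lines_closed_bound[OF no'] by auto
    show "j \<notin> U \<and> (h j \<in> V' \<longrightarrow> h j \<in> V)" if "j < length P" "j \<notin> U \<union> {i..<length P}" for j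
      using that mono[of j] V' by auto
    show "V' \<inter> {..<h j} \<subseteq> V" if "j \<in> set S" for j
      using V' mono[OF S[OF that]] by auto
  qed auto
  moreover have "map (\<lambda>i. First (?h i)) S = map (\<lambda>i. First (h i)) S"
    using inv by (auto simp: nd_to_no_inv_def)
  ultimately show ?case
    using no' by (intro exI[of _ ?h] exI[of _ V'])
      (simp add: last(2) nd_to_no_shrink R_def del: fun_upd_apply map_eq_conv)
qed

lemma no_linearly_simulates_nd:
  assumes "classical_frege_system F"
  shows "linearly_simulates (no_proof F) (nd_proof F)"
proof -
  have "tautology (Or (Var 0) (Neg (Var 0)))" "tautology (Imp (Var 1) (Imp (Var 0) (Var 1)))"
    "tautology (Imp (Neg (Var 0)) (Imp (Var 0) (Var 1)))"
    by (simp_all add: tautology_def)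
  then obtain D0 D1 D2 where D: "derivation F {} D0" "Or (Var 0) (Neg (Var 0)) \<in> set D0"
    "derivation F {} D1" "Imp (Var 1) (Imp (Var 0) (Var 1)) \<in> set D1"
    "derivation F {} D2" "Imp (Neg (Var 0)) (Imp (Var 0) (Var 1)) \<in> set D2"
    using classical_frege_system_derivation[OF assms] by meson
  have "no_proof F (translation (nd_to_no D0 D1 D2) P) A" if P: "nd_proof F P A" for P A
  proof -
    obtain S U where "nd_lines F P S U" "P \<noteq> []" "last P = ([], A)"
      using P unfolding nd_proof_def by blast
    with nd_to_no_simulation[OF D this(1)] show ?thesis
      by (auto simp: no_proof_def nd_to_no_inv_def embeds_def)
  qed
  with computable_nd_to_no length_nd_to_no show ?thesis by (rule linearly_simulates_translation)
qed

section \<open>From nested disjunction to nested deduction\<close>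

text \<open>A second assumption \<open>B\<close> equal to the first one cannot be told from a repetition of \<open>B\<close> inside
  the first block, but it need not be: \<open>B\<close> is then derived again from \<open>B \<supset> B\<close> and the block is
  kept open, and closing it yields both premises of the disjunction elimination at once.
  For this reason every line that leaves the context unchanged is preceded by the derivation of
  \<open>p \<supset> p\<close> given as a parameter.\<close>

definition no_to_nd :: "form list \<Rightarrow> form list \<times> line \<times> line \<Rightarrow> line list" where
  "no_to_nd D x =
    (let \<Gamma> = fst (fst (snd x)); Y = snd (fst (snd x)); \<Delta> = fst (snd (snd x));
         X = snd (snd (snd x)); A = hd (fst x); B = hd (rev \<Gamma>) in
     if length \<Delta> = Suc (length \<Gamma>) then [(\<Delta>, X)]
     else if length \<Delta> = length \<Gamma> then
       if \<Delta> = \<Gamma> then map (Pair \<Delta>) (map (subst (pair_subst X X)) D) @ [(\<Delta>, X)]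
       else [(rev (tl (rev \<Delta>)), Imp A Y), (\<Delta>, X)]
     else [(\<Delta>, Imp B Y), (\<Delta>, or_elim_schema A B Y), (\<Delta>, Imp (Imp B Y) (Imp (Or A B) Y)),
           (\<Delta>, Imp (Or A B) Y), (\<Delta>, X)])"

lemma computable_no_to_nd: "computable (no_to_nd D)"
  unfolding no_to_nd_def[abs_def] Let_def or_elim_schema_def by (intro computable_intros)

lemma length_no_to_nd: "length (no_to_nd D x) \<le> length D + 5"
  by (simp add: no_to_nd_def Let_def)

lemma no_to_nd_grow: "no_to_nd D (k, p, (fst p @ [X], X)) = [(fst p @ [X], X)]"
  by (simp add: no_to_nd_def)

lemma no_to_nd_same: "no_to_nd D (k, p, (fst p, X)) =
    map (Pair (fst p)) (map (subst (pair_subst X X)) D) @ [(fst p, X)]"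
  by (simp add: no_to_nd_def Let_def)

text \<open>A changed last assumption at equal length reveals a second block. The deduction rule
  first closes the block of \<open>A\<close>, leaving \<open>Imp A C\<close> in the outer context
  for later use.\<close>

lemma no_to_nd_second: "A \<noteq> B \<Longrightarrow> no_to_nd D (A # k, (\<Gamma> @ [A], C), (\<Gamma> @ [B], B)) =
    [(\<Gamma>, Imp A C), (\<Gamma> @ [B], B)]"
  by (simp add: no_to_nd_def)

text \<open>When the pair is closed, \<open>A\<close> has left the context and is recovered from the
  stack. After \<open>B\<close> is discharged, the disjunction schema and three uses of modus ponens
  give \<open>C\<close>.\<close>

lemma no_to_nd_shrink: "no_to_nd D (A # k, (\<Gamma> @ [B], C), (\<Gamma>, C)) =
    [(\<Gamma>, Imp B C), (\<Gamma>, or_elim_schema A B C), (\<Gamma>, Imp (Imp B C) (Imp (Or A B) C)),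
     (\<Gamma>, Imp (Or A B) C), (\<Gamma>, C)]"
  by (simp add: no_to_nd_def Let_def)

fun first_start :: "block \<Rightarrow> nat" where
  "first_start (First i) = i"
| "first_start (Second i k) = i"

text \<open>Both blocks of a pair start at the same depth, so passing from the first to the second
  leaves the stack alone; its entry remains the assumption at \<open>first_start\<close>.\<close>

lemma no_lines_stack:
  "no_lines F P S U \<Longrightarrow>
     stack c P = map (\<lambda>b. snd (P ! first_start b)) S \<and> (\<forall>b \<in> set S. first_start b < length P)"
proof (induction rule: no_lines.induct)
  case no_empty
  show ?case by simp
next
  case (no_or_elim P i k S U \<Gamma> A B C)
  then have "P \<noteq> []" by auto
  with no_or_elim(6) have "current_ctx P = \<Gamma> @ [B]" by (simp add: current_ctx_def)
  with no_or_elim.IH show ?case by (auto simp: stack_snoc nth_append less_Suc_eq)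
qed (auto simp: stack_snoc nth_append less_Suc_eq)

text \<open>If \<open>A = B\<close>, the one implication obtained by closing the block serves as
  both premises. Otherwise \<open>Imp A C\<close> stands before the block and survives its
  closing.\<close>

lemma nd_lines_or_elim:
  assumes lines: "nd_lines F Q (t # T) V" and conclusion: "last Q = (\<Gamma> @ [B], C)"
    and disj: "available Q V \<Gamma> (Or A B)"
    and imp: "A = B \<or> available (take t Q) V \<Gamma> (Imp A C)"
    and ax: "axiom_instance F (or_elim_schema A B C)"
  shows "nd_lines F (Q @ [(\<Gamma>, Imp B C), (\<Gamma>, or_elim_schema A B C),
    (\<Gamma>, Imp (Imp B C) (Imp (Or A B) C)), (\<Gamma>, Imp (Or A B) C), (\<Gamma>, C)]) T
    (V \<union> {t..<length Q})"
proof -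
  note blocks = nd_lines_open_blocks[OF lines]
  have t: "t < length Q" using blocks by auto
  then have "current_ctx Q = \<Gamma> @ [B]" using conclusion by (auto simp: current_ctx_def)
  with blocks have start: "Q ! t = (\<Gamma> @ [B], B)"
    and inside: "\<And>m. t \<le> m \<Longrightarrow> m < length Q \<Longrightarrow> length \<Gamma> < length (fst (Q ! m))"
    by auto
  let ?Q = "Q @ [(\<Gamma>, Imp B C)]" and ?V = "V \<union> {t..<length Q}"
  have closed: "nd_lines F ?Q T ?V"
    by (rule nd_deduction[OF lines start conclusion])
  have old: "available ?Q ?V \<Gamma> X" if X: "available (take t Q) V \<Gamma> X" for X
  proof -
    obtain j where "j < t" "j \<notin> V" "prefix (fst (Q ! j)) \<Gamma>" "snd (Q ! j) = X"
      using X t by (auto simp: available_def)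
    then show ?thesis
      using t unfolding available_def by (intro exI[of _ j]) (auto simp: nth_append)
  qed
  obtain j where j: "j < length Q" "j \<notin> V" "prefix (fst (Q ! j)) \<Gamma>" "snd (Q ! j) = Or A B"
    using disj by (auto simp: available_def)
  \<comment> \<open>All lines since \<open>t\<close> have contexts longer than \<Gamma>, so a line
    available in \<Gamma> was written before the block.\<close>
  then have "j < t" using inside[of j] prefix_length_le[OF j(3)] by fastforce
  with j t have "available (take t Q) V \<Gamma> (Or A B)"
    unfolding available_def by (intro exI[of _ j]) auto
  then have "available ?Q ?V \<Gamma> (Or A B)" by (rule old)
  moreover have BC: "available ?Q ?V \<Gamma> (Imp B C)"
    using blocks by (intro available_new[of \<Gamma>]) auto
  moreover have "available ?Q ?V \<Gamma> (Imp A C)" using imp BC old by blast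
  ultimately have avail: "available ?Q ?V (current_ctx ?Q) X"
    if "X \<in> {Imp A C, Imp B C, Or A B}" for X
    using that by auto
  let ?H = "{Imp A C, Imp B C, Or A B}"
  have "derivation F ?H ([] @ [or_elim_schema A B C])"
    by (intro derivation_axiom derivation_Nil ax)
  then have "derivation F ?H ([or_elim_schema A B C] @ [Imp (Imp B C) (Imp (Or A B) C)])"
    by (intro derivation_mp[of _ _ _ "Imp A C"]) (auto simp: or_elim_schema_def)
  then have "derivation F ?H
      ([or_elim_schema A B C, Imp (Imp B C) (Imp (Or A B) C)] @ [Imp (Or A B) C])"
    by (intro derivation_mp[of _ _ _ "Imp B C"]) auto
  then have "derivation F ?H
      ([or_elim_schema A B C, Imp (Imp B C) (Imp (Or A B) C), Imp (Or A B) C] @ [C])"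
    by (intro derivation_mp[of _ _ _ "Or A B"]) auto
  from nd_lines_derivation[OF closed avail this] show ?thesis by simp
qed

text \<open>\<open>t\<close> is the start of the single deduction block that represents the pair. In
  the second phase either the assumptions coincide or \<open>Imp A C\<close> was derived before
  \<open>t\<close>, with \<open>C\<close> read at \<open>k - 1\<close>, the end of the first block.
  The inequality \<open>h i \<le> t\<close> covers both a block kept open at \<open>h i\<close> and
  a new one.\<close>

fun block_inv :: "(nat \<Rightarrow> nat) \<Rightarrow> line list \<Rightarrow> nat set \<Rightarrow> line list \<Rightarrow> nat set \<Rightarrow> block \<Rightarrow> nat \<Rightarrow> bool"
where
  "block_inv h P U Q V (First i) t \<longleftrightarrow> i < length P \<and> t = h i"
| "block_inv h P U Q V (Second i k) t \<longleftrightarrow> i < k \<and> k < length P \<and> h i \<le> t \<and> {i..<k} \<subseteq> U \<and>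
     (snd (P ! i) = snd (P ! k) \<or>
      available (take t Q) V (butlast (fst (P ! k))) (Imp (snd (P ! i)) (snd (P ! (k - 1)))))"

lemma block_inv_snoc:
  assumes "block_inv h P U Q V b t" "U \<subseteq> U'" "V' \<inter> {..<t} \<subseteq> V" "t \<le> length Q"
  shows "block_inv (h(length P := m)) (P @ [l]) U' (Q @ R) V' b t"
proof (cases b)
  case (First i)
  then show ?thesis using assms(1) by auto
next
  case (Second i k)
  then have k: "i < k" "k < length P" "h i \<le> t" "{i..<k} \<subseteq> U" and
    imp: "snd (P ! i) = snd (P ! k) \<or>
      available (take t Q) V (butlast (fst (P ! k))) (Imp (snd (P ! i)) (snd (P ! (k - 1))))"
    using assms(1) by auto
  then have nth: "(P @ [l]) ! i = P ! i" "(P @ [l]) ! k = P ! k" "(P @ [l]) ! (k - 1) = P ! (k - 1)"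
    by (auto simp: nth_append)
  have "snd (P ! i) = snd (P ! k) \<or> available (take t (Q @ R)) V' (butlast (fst (P ! k)))
      (Imp (snd (P ! i)) (snd (P ! (k - 1))))"
    using imp available_take_mono[OF _ assms(3,4)] by blast
  then show ?thesis
    using k assms(2) Second nth by (auto simp del: take_append)
qed

definition no_to_nd_inv where
  "no_to_nd_inv h P S U Q T V \<longleftrightarrow> embeds h P Q \<and> (\<forall>i < length P. i \<notin> U \<longrightarrow> h i \<notin> V) \<and>
     list_all2 (block_inv h P U Q V) S T"

lemma no_to_nd_inv_snoc:
  assumes inv: "no_to_nd_inv h P S U Q T V"
    and blocks: "list_all2 (block_inv h P U Q V) S' T'"
    and U: "U \<subseteq> U'" and V': "length Q + length R \<notin> V'"
    and live: "\<And>i. i < length P \<Longrightarrow> i \<notin> U' \<Longrightarrow> h i \<in> V' \<Longrightarrow> h i \<in> V"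
    and T': "\<And>t. t \<in> set T' \<Longrightarrow> t \<le> length Q \<and> V' \<inter> {..<t} \<subseteq> V"
  shows "no_to_nd_inv (h(length P := length Q + length R)) (P @ [l]) S' U' (Q @ R @ [l]) T' V'"
proof -
  let ?h = "h(length P := length Q + length R)"
  note I = inv[unfolded no_to_nd_inv_def]
  have "?h i \<notin> V'" if "i < length (P @ [l])" "i \<notin> U'" for i
  proof (cases "i = length P")
    case False
    then have "i < length P" using that(1) by simp
    then have "h i \<notin> V'" using I live U that(2) by blast
    with False show ?thesis by simp
  qed (use V' in simp)
  moreover have "list_all2 (block_inv ?h (P @ [l]) U' (Q @ R @ [l]) V') S' T'"
    using blocks
    by (rule list.rel_mono_strong) (use block_inv_snoc U T' in blast)
  ultimately show ?thesis
    unfolding no_to_nd_inv_def using embeds_snoc[OF conjunct1[OF I], of R l] by blast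
qed

text \<open>Induction over the rules: each open pair corresponds to exactly one open deduction
  block. Opening a second block splits on whether its assumption repeats the first one.\<close>

lemma no_to_nd_simulation:
  assumes D: "derivation F {} D" "Imp (Var 0) (Var 0) \<in> set D"
    and ax: "\<And>A B C. axiom_instance F (or_elim_schema A B C)"
    and "no_lines F P S U"
  shows "\<exists>h T V. nd_lines F (translation (no_to_nd D) P) T V \<and>
    no_to_nd_inv h P S U (translation (no_to_nd D) P) T V"
  using assms(4)
proof induction
  case no_empty
  show ?case
    by (intro exI[of _ "[]"] exI[of _ "{}"] exI[of _ id])
      (simp add: no_to_nd_inv_def embeds_def nd_empty)
next
  case (no_axiom P S U A)
  let ?Q = "translation (no_to_nd D) P" and ?E = "map (subst (pair_subst A A)) D"
  obtain h T V where nd: "nd_lines F ?Q T V" and inv: "no_to_nd_inv h P S U ?Q T V"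
    using no_axiom by blast
  have ctx: "current_ctx ?Q = current_ctx P"
    using inv embeds_current_ctx unfolding no_to_nd_inv_def by blast
  have "derivation F {} (?E @ [A])"
    by (intro derivation_axiom derivation_subst D no_axiom)
  from nd_lines_derivation[OF nd _ this]
  have nd': "nd_lines F (?Q @ map (Pair (current_ctx P)) ?E @ [(current_ctx P, A)]) T V"
    by (simp add: ctx)
  moreover have "no_to_nd_inv (h(length P := length ?Q + length (map (Pair (current_ctx P)) ?E)))
      (P @ [(current_ctx P, A)]) S U
      (?Q @ map (Pair (current_ctx P)) ?E @ [(current_ctx P, A)]) T V"
    using nd_lines_open_blocks[OF nd] open_blocks_less inv
    by (intro no_to_nd_inv_snoc[OF inv]) (auto simp: no_to_nd_inv_def less_imp_le)
  moreover have "translation (no_to_nd D) (P @ [(current_ctx P, A)]) =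
      ?Q @ map (Pair (current_ctx P)) ?E @ [(current_ctx P, A)]"
    using no_to_nd_same[of D "stack (no_to_nd D) P" "previous P" A] by simp
  ultimately show ?case by metis
next
  case (no_mp P S U A B)
  let ?Q = "translation (no_to_nd D) P" and ?E = "map (subst (pair_subst B B)) D"
  obtain h T V where nd: "nd_lines F ?Q T V" and inv: "no_to_nd_inv h P S U ?Q T V"
    using no_mp by blast
  have ctx: "current_ctx ?Q = current_ctx P"
    using inv embeds_current_ctx unfolding no_to_nd_inv_def by blast
  have avail: "available ?Q V (current_ctx ?Q) X" if "X \<in> {A, Imp A B}" for X
  proof -
    have "available P U (current_ctx P) X" using that no_mp(2,3) by auto
    then show ?thesis using inv available_embeds unfolding no_to_nd_inv_def ctx by blast
  qed
  have "derivation F {A, Imp A B} (?E @ [B])"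
    by (intro derivation_mp[of _ _ _ A] derivation_weaken[OF derivation_subst] D) auto
  from nd_lines_derivation[OF nd avail this]
  have nd': "nd_lines F (?Q @ map (Pair (current_ctx P)) ?E @ [(current_ctx P, B)]) T V"
    by (simp add: ctx)
  moreover have "no_to_nd_inv (h(length P := length ?Q + length (map (Pair (current_ctx P)) ?E)))
      (P @ [(current_ctx P, B)]) S U
      (?Q @ map (Pair (current_ctx P)) ?E @ [(current_ctx P, B)]) T V"
    using nd_lines_open_blocks[OF nd] open_blocks_less inv
    by (intro no_to_nd_inv_snoc[OF inv]) (auto simp: no_to_nd_inv_def less_imp_le)
  moreover have "translation (no_to_nd D) (P @ [(current_ctx P, B)]) =
      ?Q @ map (Pair (current_ctx P)) ?E @ [(current_ctx P, B)]"
    using no_to_nd_same[of D "stack (no_to_nd D) P" "previous P" B] by simp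
  ultimately show ?case by metis
next
  case (no_assume P S U A)
  let ?Q = "translation (no_to_nd D) P" and ?l = "(current_ctx P @ [A], A)"
  obtain h T V where nd: "nd_lines F ?Q T V" and inv: "no_to_nd_inv h P S U ?Q T V"
    using no_assume by blast
  let ?h = "h(length P := length ?Q + length ([] :: line list))"
  have ctx: "current_ctx ?Q = current_ctx P"
    using inv embeds_current_ctx unfolding no_to_nd_inv_def by blast
  have nd': "nd_lines F (?Q @ [] @ [?l]) (length ?Q # T) V"
    using nd_assume[OF nd, of A] by (simp add: ctx)
  have "no_to_nd_inv ?h (P @ [?l]) S U (?Q @ [] @ [?l]) T V"
    using nd_lines_open_blocks[OF nd] open_blocks_less inv
    by (intro no_to_nd_inv_snoc[OF inv]) (auto simp: no_to_nd_inv_def less_imp_le)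
  then have "no_to_nd_inv ?h (P @ [?l]) (First (length P) # S) U (?Q @ [] @ [?l])
      (length ?Q # T) V"
    by (simp add: no_to_nd_inv_def)
  moreover have "translation (no_to_nd D) (P @ [?l]) = ?Q @ [] @ [?l]"
    using no_to_nd_grow[of D "stack (no_to_nd D) P" "previous P" A] by simp
  ultimately show ?case using nd' by metis
next
  case (no_assume_second P i S U \<Gamma> A B)
  let ?Q = "translation (no_to_nd D) P" and ?l = "(\<Gamma> @ [B], B)"
    and ?U = "U \<union> {i..<length P}"
  obtain h T' V where nd: "nd_lines F ?Q T' V"
    and inv: "no_to_nd_inv h P (First i # S) U ?Q T' V" using no_assume_second by blast
  have emb: "embeds h P ?Q" using inv by (simp add: no_to_nd_inv_def)
  obtain T where T': "T' = h i # T" and i: "i < length P"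
    and rest: "list_all2 (block_inv h P U ?Q V) S T"
    using inv by (auto simp: no_to_nd_inv_def list_all2_Cons1)
  have ctx: "current_ctx ?Q = \<Gamma> @ [A]"
    using embeds_current_ctx[OF emb] no_assume_second(2) by simp
  note blocks = nd_lines_open_blocks[OF nd, unfolded T' ctx]
  \<comment> \<open>The rule gives the current context but not the line at \<open>i\<close>. The
    open blocks of the output determine the copy of that line, and \<open>embeds\<close> carries it
    back to \<open>P\<close>.\<close>
  have start: "?Q ! h i = (\<Gamma> @ [A], A)" and hi: "h i < length ?Q" using blocks by auto
  have Pi: "P ! i = (\<Gamma> @ [A], A)" using emb i start by (simp add: embeds_def)
  have "P \<noteq> []" using i by auto
  have mono: "h j < h i" if "j < i" for j
    using emb that i unfolding embeds_def by blast
  have T: "t < h i" if "t \<in> set T" for t using blocks that by auto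
  show ?case
  proof (cases "A = B")
    case True
    define R where "R = map (Pair (\<Gamma> @ [B])) (map (subst (pair_subst B B)) D)"
    let ?h = "h(length P := length ?Q + length R)"
    have "available ?Q V (current_ctx ?Q) B"
      unfolding available_def using blocks start True ctx by (intro exI[of _ "h i"]) auto
    moreover have "Imp B B \<in> set (map (subst (pair_subst B B)) D)"
      using D(2) by (force simp: pair_subst_def)
    then have "derivation F {B} (map (subst (pair_subst B B)) D @ [B])"
      by (intro derivation_mp[of _ _ _ B] derivation_weaken[OF derivation_subst] D) auto
    ultimately have nd': "nd_lines F (?Q @ R @ [?l]) (h i # T) V"
      using nd_lines_derivation[OF nd, of "{B}"
          "map (subst (pair_subst B B)) D @ [B]"] True ctx by (simp add: R_def T')
    \<comment> \<open>\<open>V\<close> stays as it is although \<open>U\<close> grows: the first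
      block remains available in the output, which the invariant allows.\<close>
    have inv': "no_to_nd_inv ?h (P @ [?l]) S ?U (?Q @ R @ [?l]) T V"
    proof (rule no_to_nd_inv_snoc[OF inv rest])
      show "length ?Q + length R \<notin> V" using blocks by auto
      show "t \<le> length ?Q \<and> V \<inter> {..<t} \<subseteq> V" if "t \<in> set T" for t
        using T[OF that] hi by auto
    qed auto
    have "block_inv ?h (P @ [?l]) ?U (?Q @ R @ [?l]) V (Second i (length P)) (h i)"
      using i Pi True by (simp add: nth_append)
    with inv' have "no_to_nd_inv ?h (P @ [?l]) (Second i (length P) # S) ?U (?Q @ R @ [?l])
        (h i # T) V"
      by (simp add: no_to_nd_inv_def del: block_inv.simps fun_upd_apply)
    moreover have "translation (no_to_nd D) (P @ [?l]) = ?Q @ R @ [?l]"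
      using no_to_nd_same[of D "stack (no_to_nd D) P" "previous P" B] True no_assume_second(2)
      by (simp add: R_def)
    ultimately show ?thesis using nd' by metis
  next
    case False
    define C where "C = snd (last P)"
    have last: "last ?Q = (\<Gamma> @ [A], C)" "previous P = (\<Gamma> @ [A], C)"
      using emb \<open>P \<noteq> []\<close> no_assume_second(2)
      by (auto simp: C_def embeds_def previous_def current_ctx_def prod_eq_iff)
    let ?R = "[(\<Gamma>, Imp A C)]" and ?V = "V \<union> {h i..<length ?Q}"
    let ?h = "h(length P := length ?Q + length ?R)"
    have nd': "nd_lines F (?Q @ ?R @ [?l]) (length (?Q @ ?R) # T) ?V"
      using nd_assume[OF nd_deduction[OF nd[unfolded T'] start last(1)], of B] by simp
    have inv': "no_to_nd_inv ?h (P @ [?l]) S ?U (?Q @ ?R @ [?l]) T ?V"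
    proof (rule no_to_nd_inv_snoc[OF inv rest])
      show "length ?Q + length ?R \<notin> ?V" using blocks by auto
      show "h j \<in> V" if "j < length P" "j \<notin> ?U" "h j \<in> ?V" for j
        using that mono[of j] by auto
      show "t \<le> length ?Q \<and> ?V \<inter> {..<t} \<subseteq> V" if "t \<in> set T" for t
        using T[OF that] hi by auto
    qed auto
    have "available (?Q @ ?R) ?V \<Gamma> (Imp A C)"
      using blocks by (intro available_new[of \<Gamma>]) auto
    \<comment> \<open>The second block starts at \<open>length P\<close>, so position
      \<open>k - 1\<close> of \<open>block_inv\<close> is the last line of \<open>P\<close>.\<close>
    moreover have "(P @ [?l]) ! (length P - 1) = last P" "(P @ [?l]) ! i = P ! i"
      using \<open>P \<noteq> []\<close> i by (auto simp: nth_append last_conv_nth)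
    moreover have "h i \<le> length (?Q @ ?R)" using hi by simp
    ultimately have "block_inv ?h (P @ [?l]) ?U (?Q @ ?R @ [?l]) ?V (Second i (length P))
        (length (?Q @ ?R))"
      using i Pi by (simp add: C_def)
    with inv' have "no_to_nd_inv ?h (P @ [?l]) (Second i (length P) # S) ?U (?Q @ ?R @ [?l])
        (length (?Q @ ?R) # T) ?V"
      by (simp add: no_to_nd_inv_def del: block_inv.simps fun_upd_apply)
    moreover have "stack (no_to_nd D) P = A # map (\<lambda>b. snd (P ! first_start b)) S"
      using no_lines_stack[OF no_assume_second(1), of "no_to_nd D"] Pi by simp
    then have "translation (no_to_nd D) (P @ [?l]) = ?Q @ ?R @ [?l]"
      using no_to_nd_second[OF False] last(2) by simp
    ultimately show ?thesis using nd' by metis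
  qed
next
  case (no_or_elim P i k S U \<Gamma> A B C)
  let ?Q = "translation (no_to_nd D) P" and ?l = "(\<Gamma>, C)"
  obtain h T' V where nd: "nd_lines F ?Q T' V"
    and inv: "no_to_nd_inv h P (Second i k # S) U ?Q T' V" using no_or_elim by blast
  have emb: "embeds h P ?Q" using inv by (simp add: no_to_nd_inv_def)
  obtain t T where T': "T' = t # T" and ik: "i < k" "k < length P" "h i \<le> t" "{i..<k} \<subseteq> U"
    and imp: "A = B \<or> available (take t ?Q) V \<Gamma> (Imp A C)"
    and rest: "list_all2 (block_inv h P U ?Q V) S T"
    using inv no_or_elim(3-5) by (auto simp: no_to_nd_inv_def list_all2_Cons1)
  have "P \<noteq> []" using ik by auto
  then have last: "last ?Q = (\<Gamma> @ [B], C)" "previous P = (\<Gamma> @ [B], C)"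
    using emb no_or_elim(6) by (auto simp: embeds_def previous_def)
  note blocks = nd_lines_open_blocks[OF nd, unfolded T']
  have t: "t < length ?Q" using blocks by auto
  have mono: "h j < t" if "j < i" for j
  proof -
    have "h j < h i" using emb that ik unfolding embeds_def by (meson less_trans)
    then show ?thesis using ik(3) by simp
  qed
  have T: "s < t" if "s \<in> set T" for s using blocks that by auto
  have disj: "available ?Q V \<Gamma> (Or A B)"
    using inv available_embeds no_or_elim(2) unfolding no_to_nd_inv_def by blast
  define R where "R = [(\<Gamma>, Imp B C), (\<Gamma>, or_elim_schema A B C),
    (\<Gamma>, Imp (Imp B C) (Imp (Or A B) C)), (\<Gamma>, Imp (Or A B) C)]"
  let ?V = "V \<union> {t..<length ?Q}"
  have nd': "nd_lines F (?Q @ R @ [?l]) T ?V"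
    using nd_lines_or_elim[OF nd[unfolded T'] last(1) disj imp ax] by (simp add: R_def)
  have "no_to_nd_inv (h(length P := length ?Q + length R)) (P @ [?l]) S (U \<union> {k..<length P})
      (?Q @ R @ [?l]) T ?V"
  proof (rule no_to_nd_inv_snoc[OF inv rest])
    show "length ?Q + length R \<notin> ?V" using blocks by auto
    show "h j \<in> V" if "j < length P" "j \<notin> U \<union> {k..<length P}" "h j \<in> ?V" for j
    proof -
      \<comment> \<open>Positions from \<open>i\<close> to \<open>k - 1\<close> were closed when the
        second block opened, and those from \<open>k\<close> on are closed now. A live line thus
        precedes \<open>i\<close>, and its copy precedes \<open>t\<close>.\<close>
      have "j < i" by (rule ccontr) (use that(1,2) ik(4) in \<open>auto simp: subset_iff\<close>)
      then show ?thesis using mono[of j] that(3) by auto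
    qed
    show "s \<le> length ?Q \<and> ?V \<inter> {..<s} \<subseteq> V" if "s \<in> set T" for s
      using T[OF that] t by auto
  qed auto
  moreover have "stack (no_to_nd D) P = A # map (\<lambda>b. snd (P ! first_start b)) S"
    using no_lines_stack[OF no_or_elim(1), of "no_to_nd D"] no_or_elim(3) by simp
  then have "translation (no_to_nd D) (P @ [?l]) = ?Q @ R @ [?l]"
    using no_to_nd_shrink last(2) by (simp add: R_def)
  ultimately show ?case using nd' by metis
qed

lemma nd_linearly_simulates_no:
  assumes "classical_frege_system F"
  shows "linearly_simulates (nd_proof F) (no_proof F)"
proof -
  have "tautology (Imp (Var 0) (Var 0))" by (simp add: tautology_def)
  then obtain D where D: "derivation F {} D" "Imp (Var 0) (Var 0) \<in> set D"
    using classical_frege_system_derivation[OF assms] by meson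
  have "nd_proof F (translation (no_to_nd D) P) A" if P: "no_proof F P A" for P A
  proof -
    obtain S U where "no_lines F P S U" "P \<noteq> []" "last P = ([], A)"
      using P unfolding no_proof_def by blast
    with no_to_nd_simulation[OF D classical_frege_system_or_elim[OF assms] this(1)]
    show ?thesis
      by (auto simp: nd_proof_def no_to_nd_inv_def embeds_def)
  qed
  with computable_no_to_nd length_no_to_nd show ?thesis by (rule linearly_simulates_translation)
qed

theorem theorem6:
  fixes F :: "form set"
  assumes "classical_frege_system F"
  shows "linearly_simulates (no_proof F) (nd_proof F) \<and>
         linearly_simulates (nd_proof F) (no_proof F)"
  using no_linearly_simulates_nd[OF assms] nd_linearly_simulates_no[OF assms] ..

end
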